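(* Let $(\mathbf{X}^{(n)})_{n\in\mathbb{N}}$ be a sequence of random graphs with $\mathbf{X}^{(n)}\sim\mathrm{LERGM}(\beta^\star)$, $\beta^\star=(\beta_W^\star,\beta_B^\star)\in\mathbb{R}^{d_1}\times\mathbb{R}^{d_2}$, as described in the context. Suppose that the following three assumptions hold. (A1) With $R_W,R_B>0$ independent of $n$, $B_W=\{\beta_W\in\mathbb{R}^{d_1}:\|\beta_W\|\le R_W\}$ and $B_B=\{\beta_B\in\mathbb{R}^{d_2}:\|\beta_B\|\le R_B\}$, the points $\beta_W^\star$ and $\beta_B^\star$ lie in the interior of $B_W$ and $B_B$, respectively. (A2) There exist constants $L_W,L_B,C_W,C_B\ge 0$ independent of $n$ such that $\|\Delta_m s^{(n)}_{k,k}(x_{k,k})\|\le L_W M_n^{C_W}$ for all $n\in\mathbb{N}$, $1\le k\le K_n$, $x_{k,k}\in\mathbb{X}^{(n)}_{k,k}$, $m\in E^{(n)}_{k,k}$, and $\|\Delta_m s^{(n)}_{k,l}(x_{k,l})\|\le L_B M_n^{C_B}$ for all $n\in\mathbb{N}$, $1\le k<l\le K_n$, $x_{k,l}\in\mathbb{X}^{(n)}_{k,l}$, $m\in E^{(n)}_{k,l}$. (A3) There exist $\xi_W,\xi_B>0$ independent of $n$ such that for all $n\in\mathbb{N}$ $$\min_{1\le k\le K_n}\lambda_{\min}\Big(\sum_{m\in E^{(n)}_{k,k}}\mathbb{E}\big[\Delta_m s^{(n)}_{k,k}(\mathbf{X}^{(n)}_{k,k})\,\Delta_m s^{(n)}_{k,k}(\mathbf{X}^{(n)}_{k,k})^\top\big]\Big)\ge\xi_W,$$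 $$\min_{1\le k<l\le K_n}\lambda_{\min}\Big(\sum_{m\in E^{(n)}_{k,l}}\mathbb{E}\big[\Delta_m s^{(n)}_{k,l}(\mathbf{X}^{(n)}_{k,l})\,\Delta_m s^{(n)}_{k,l}(\mathbf{X}^{(n)}_{k,l})^\top\big]\Big)\ge\xi_B.$$ Let $(\hat\beta_W^{(n)},\hat\beta_B^{(n)})$ be a Stein estimator, i.e. $\hat\beta_W^{(n)}\in\operatorname{argmin}_{\beta_W\in B_W}G_W^{(n)}(\mathbf{X}^{(n)},\beta_W)$ and $\hat\beta_B^{(n)}\in\operatorname{argmin}_{\beta_B\in B_B}G_B^{(n)}(\mathbf{X}^{(n)},\beta_B)$. Then for all $n\in\mathbb{N}$ and $P\in\mathbb{N}$ there exist constants $T_W,T_B>0$, independent of $n$, such that with probability at least $1-1/P$, $$\|\hat\beta_W^{(n)}-\beta_W^\star\|\le\frac{1}{\sqrt{K_n}}\,P\,T_W\,M_n^{5+C_W}\exp\big(R_WL_WM_n^{C_W}\big)$$ and $$\|\hat\beta_B^{(n)}-\beta_B^\star\|\le\frac{1}{\sqrt{K_n}}\,P\,T_B\,M_n^{5+C_B}\exp\big(R_BL_BM_n^{C_B}\big).$$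
   Context: Notation. $\|\cdot\|$ is the Euclidean norm, $\langle\cdot,\cdot\rangle$ the standard scalar product, $\lambda_{\min}$ the smallest eigenvalue, $\Sigma(t)=\log(1+e^t)$. For each $n\in\mathbb{N}$, a finite vertex set $A^{(n)}$ is partitioned into $K_n$ nonempty blocks $A_1^{(n)},\dots,A_{K_n}^{(n)}$, and $M_n=\max_k|A_k^{(n)}|$. $E^{(n)}_{k,k}$ is the set of unordered pairs of distinct vertices of $A^{(n)}_k$ (possible within-block edges); for $k<l$, $E^{(n)}_{k,l}$ is the set of pairs $(u,v)$ with $u\in A^{(n)}_k$, $v\in A^{(n)}_l$ (possible between-block edges). $\mathbb{X}^{(n)}_{k,l}=\{0,1\}^{E^{(n)}_{k,l}}$ is the set of possible subgraphs, and $\mathbb{X}^{(n)}=\prod_{1\le k\le l\le K_n}\mathbb{X}^{(n)}_{k,l}$ is the set of simple undirected graphs on $A^{(n)}$; $x=(x_{k,l})_{k\le l}$. For $m\in E^{(n)}_{k,l}$, $\Diamond_m^1x_{k,l}$ (resp. $\Diamond_m^0x_{k,l}$) is $x_{k,l}$ with the indicator of edge $m$ set to $1$ (resp. $0$), and $\Delta_mf(x_{k,l})=f(\Diamond_m^1x_{k,l})-f(\Diamond_m^0x_{k,l})$. Statistics $s^{(n)}_{k,k}:\mathbb{X}^{(n)}_{k,k}\to\mathbb{R}^{d_1}$ and $s^{(n)}_{k,l}:\mathbb{X}^{(n)}_{k,l}\to\mathbb{R}^{d_2}$ ($k<l$) are given; $d_1,d_2$ and $\beta^\star$ do not depend on $n$,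 everything else may. $\mathbf{X}^{(n)}\sim\mathrm{LERGM}(\beta^\star)$ (local dependency exponential random graph model) means that $\mathbf{X}^{(n)}$ is a random element of $\mathbb{X}^{(n)}$ with probability mass function $$p^{(n)}(x)\propto\exp\Big(\sum_{1\le k\le K_n}\langle\beta_W^\star,s^{(n)}_{k,k}(x_{k,k})\rangle+\sum_{1\le k<l\le K_n}\langle\beta_B^\star,s^{(n)}_{k,l}(x_{k,l})\rangle\Big).$$ $\mathbf{X}^{(n)}_{k,l}$ denotes the $(k,l)$-subgraph of $\mathbf{X}^{(n)}$. No assumption is made on the joint distribution of the $\mathbf{X}^{(n)}$ for different $n$. Target functions: $$G_W^{(n)}(x,\beta_W)=\sum_{1\le k\le K_n}\sum_{m\in E^{(n)}_{k,k}}\big(\Sigma(\langle\beta_W,\Delta_ms^{(n)}_{k,k}(x_{k,k})\rangle)+\langle\beta_W,s^{(n)}_{k,k}(\Diamond_m^0x_{k,k})-s^{(n)}_{k,k}(x_{k,k})\rangle\big),$$ $$G_B^{(n)}(x,\beta_B)=\sum_{1\le k<l\le K_n}\sum_{m\in E^{(n)}_{k,l}}\big(\Sigma(\langle\beta_B,\Delta_ms^{(n)}_{k,l}(x_{k,l})\rangle)+\langle\beta_B,s^{(n)}_{k,l}(\Diamond_m^0x_{k,l})-s^{(n)}_{k,l}(x_{k,l})\rangle\big).$$ If minimisers in the definition of the Stein estimator are not unique, one is picked by an arbitrary deterministic rule. Saying that $T_W,T_B$ are independent of $n$ means that the same constants work for all $n$. *)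

theory Defs
  imports "HOL-Probability.Probability"
begin

section \<open>Block-structured simple graphs\<close>

definition block_partition :: "'v set \<Rightarrow> nat \<Rightarrow> (nat \<Rightarrow> 'v set) \<Rightarrow> bool" where
  "block_partition V K A \<longleftrightarrow>
     finite V \<and> 1 \<le> K \<and> (\<forall>k\<in>{1..K}. A k \<noteq> {}) \<and>
     disjoint_family_on A {1..K} \<and> (\<Union>k\<in>{1..K}. A k) = V"

definition max_block_size :: "nat \<Rightarrow> (nat \<Rightarrow> 'v set) \<Rightarrow> nat" where
  "max_block_size K A = Max ((\<lambda>k. card (A k)) ` {1..K})"

definition block_pairs :: "nat \<Rightarrow> (nat \<times> nat) set" where
  "block_pairs K = {(k, l). 1 \<le> k \<and> k \<le> l \<and> l \<le> K}"

definition between_pairs :: "nat \<Rightarrow> (nat \<times> nat) set" where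
  "between_pairs K = {(k, l). 1 \<le> k \<and> k < l \<and> l \<le> K}"

text \<open>
  An edge is the set of its two end points. For \<open>k < l\<close> the blocks \<open>A k\<close> and \<open>A l\<close> are disjoint,
  so \<open>(u, v) \<mapsto> {u, v}\<close> is a bijection from \<open>A k \<times> A l\<close> onto \<open>block_edges A k l\<close> (and the
  condition \<open>u \<noteq> v\<close> holds automatically).
\<close>

definition block_edges :: "(nat \<Rightarrow> 'v set) \<Rightarrow> nat \<Rightarrow> nat \<Rightarrow> 'v set set" where
  "block_edges A k l = {{u, v} | u v. u \<in> A k \<and> v \<in> A l \<and> u \<noteq> v}"

type_synonym 'v subgraph = "'v set \<Rightarrow> nat"

type_synonym 'v block_graph = "nat \<times> nat \<Rightarrow> 'v subgraph"

definition subgraphs :: "(nat \<Rightarrow> 'v set) \<Rightarrow> nat \<Rightarrow> nat \<Rightarrow> 'v subgraph set" where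
  "subgraphs A k l = block_edges A k l \<rightarrow>\<^sub>E {0, 1}"

definition graphs :: "nat \<Rightarrow> (nat \<Rightarrow> 'v set) \<Rightarrow> 'v block_graph set" where
  "graphs K A = (\<Pi>\<^sub>E (k, l)\<in>block_pairs K. subgraphs A k l)"

definition set_edge :: "'e \<Rightarrow> nat \<Rightarrow> ('e \<Rightarrow> nat) \<Rightarrow> ('e \<Rightarrow> nat)" where
  "set_edge m b x = x(m := b)"

definition edge_change :: "'e \<Rightarrow> (('e \<Rightarrow> nat) \<Rightarrow> 'b::ab_group_add) \<Rightarrow> ('e \<Rightarrow> nat) \<Rightarrow> 'b" where
  "edge_change m f x = f (set_edge m 1 x) - f (set_edge m 0 x)"

section \<open>Local dependency exponential random graph model\<close>

text \<open>
  Throughout, \<open>sW k\<close> is the within-block statistic of block \<open>k\<close>, and \<open>sB k l\<close> (used only for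
  \<open>k < l\<close>) the between-block statistic of blocks \<open>k\<close> and \<open>l\<close>.
\<close>

definition lergm_weight ::
  "nat \<Rightarrow> (nat \<Rightarrow> 'v subgraph \<Rightarrow> real^'d1) \<Rightarrow> (nat \<Rightarrow> nat \<Rightarrow> 'v subgraph \<Rightarrow> real^'d2) \<Rightarrow>
   real^'d1 \<Rightarrow> real^'d2 \<Rightarrow> 'v block_graph \<Rightarrow> real" where
  "lergm_weight K sW sB \<beta>W \<beta>B x =
     exp ((\<Sum>k\<in>{1..K}. \<beta>W \<bullet> sW k (x (k, k))) +
          (\<Sum>(k, l)\<in>between_pairs K. \<beta>B \<bullet> sB k l (x (k, l))))"

definition lergm_mass ::
  "nat \<Rightarrow> (nat \<Rightarrow> 'v set) \<Rightarrow> (nat \<Rightarrow> 'v subgraph \<Rightarrow> real^'d1) \<Rightarrow>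
   (nat \<Rightarrow> nat \<Rightarrow> 'v subgraph \<Rightarrow> real^'d2) \<Rightarrow> real^'d1 \<Rightarrow> real^'d2 \<Rightarrow> 'v block_graph \<Rightarrow> real" where
  "lergm_mass K A sW sB \<beta>W \<beta>B x =
     lergm_weight K sW sB \<beta>W \<beta>B x / (\<Sum>y\<in>graphs K A. lergm_weight K sW sB \<beta>W \<beta>B y)"

definition is_LERGM ::
  "'w measure \<Rightarrow> ('w \<Rightarrow> 'v block_graph) \<Rightarrow> nat \<Rightarrow> (nat \<Rightarrow> 'v set) \<Rightarrow>
   (nat \<Rightarrow> 'v subgraph \<Rightarrow> real^'d1) \<Rightarrow> (nat \<Rightarrow> nat \<Rightarrow> 'v subgraph \<Rightarrow> real^'d2) \<Rightarrow>
   real^'d1 \<Rightarrow> real^'d2 \<Rightarrow> bool" where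
  "is_LERGM M X K A sW sB \<beta>W \<beta>B \<longleftrightarrow>
     X \<in> measurable M (count_space (graphs K A)) \<and>
     (\<forall>x\<in>graphs K A. measure M {\<omega> \<in> space M. X \<omega> = x} = lergm_mass K A sW sB \<beta>W \<beta>B x)"

section \<open>Target functions of the Stein estimator\<close>

definition softplus :: "real \<Rightarrow> real" where
  "softplus t = ln (1 + exp t)"

definition block_target ::
  "'e set \<Rightarrow> (('e \<Rightarrow> nat) \<Rightarrow> real^'d) \<Rightarrow> ('e \<Rightarrow> nat) \<Rightarrow> real^'d \<Rightarrow> real" where
  "block_target E s x \<beta> =
     (\<Sum>m\<in>E. softplus (\<beta> \<bullet> edge_change m s x) + \<beta> \<bullet> (s (set_edge m 0 x) - s x))"

definition target_W ::
  "nat \<Rightarrow> (nat \<Rightarrow> 'v set) \<Rightarrow> (nat \<Rightarrow> 'v subgraph \<Rightarrow> real^'d1) \<Rightarrow>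
   'v block_graph \<Rightarrow> real^'d1 \<Rightarrow> real" where
  "target_W K A sW x \<beta>W =
     (\<Sum>k\<in>{1..K}. block_target (block_edges A k k) (sW k) (x (k, k)) \<beta>W)"

definition target_B ::
  "nat \<Rightarrow> (nat \<Rightarrow> 'v set) \<Rightarrow> (nat \<Rightarrow> nat \<Rightarrow> 'v subgraph \<Rightarrow> real^'d2) \<Rightarrow>
   'v block_graph \<Rightarrow> real^'d2 \<Rightarrow> real" where
  "target_B K A sB x \<beta>B =
     (\<Sum>(k, l)\<in>between_pairs K. block_target (block_edges A k l) (sB k l) (x (k, l)) \<beta>B)"

section \<open>Smallest eigenvalue and second-moment matrices\<close>

text \<open>
  \<open>lambda_min\<close> is meant for symmetric matrices, whose set of real eigenvalues is finite and
  nonempty; for other matrices \<open>Min\<close> may be applied to the empty set.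
\<close>

definition lambda_min :: "real^'d^'d \<Rightarrow> real" where
  "lambda_min S = Min {c. \<exists>v. v \<noteq> 0 \<and> S *v v = c *\<^sub>R v}"

definition outer :: "real^'d \<Rightarrow> real^'d^'d" where
  "outer v = (\<chi> i j. v $ i * v $ j)"

definition change_moment_matrix ::
  "'w measure \<Rightarrow> 'e set \<Rightarrow> (('e \<Rightarrow> nat) \<Rightarrow> real^'d) \<Rightarrow> ('w \<Rightarrow> 'e \<Rightarrow> nat) \<Rightarrow> real^'d^'d" where
  "change_moment_matrix M E s Y = (\<Sum>m\<in>E. \<integral>\<omega>. outer (edge_change m s (Y \<omega>)) \<partial>M)"

end

theory Submission
  imports Defs
begin

text \<open>
  The target functions are convex, and they are logistic losses: the response is the indicator of an
  edge \<open>m\<close>, and its design vector is the change \<open>\<Delta>\<close> of the statistic caused by that edge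
  (\<open>block_target_eq_logistic_loss\<close>). Conditionally on the rest of its block, the edge
  indicator is Bernoulli with parameter \<open>logistic (\<beta> \<bullet> \<Delta>)\<close>, so at the true parameter the
  gradient of the target has mean zero
  (\<open>edge_score_mean_zero\<close>). On the ball of radius \<open>R\<close> the linear predictors \<open>\<beta> \<bullet> \<Delta>\<close> are at most
  \<open>R * L * M powr C\<close> in absolute value, so the Hessian of the target is at least
  \<open>exp (- R * L * M powr C) / 4\<close> times the sum of the matrices \<open>\<Delta> \<Delta>\<^sup>T\<close> (\<open>softplus_strongly_convex\<close>).

  Blocks are independent (\<open>lergm_mass_eq\<close>). The gradient at the true parameter is therefore a sum of
  independent centred vectors, of order \<open>M powr (2 + C)\<close> times the square root of the number of
  blocks, while the sum of the matrices \<open>\<Delta> \<Delta>\<^sup>T\<close> concentrates around its mean, which by the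
  eigenvalue assumption is at least \<open>\<xi>\<close> times the number of blocks. A minimiser cannot be
  further from the true parameter than the quotient of the gradient and the curvature; this is
  \<open>logistic_minimiser_deviation\<close>, where it is also explained why few blocks make the claim trivial.
  Both concentration statements are one Chebyshev inequality for vectors (\<open>chebyshev_sum\<close>), applied to
  matrices in the Frobenius norm. Within-block and between-block estimators are handled by the same
  lemma, each with failure probability at most \<open>1 / (2 * P)\<close>.
\<close>

section \<open>The softplus function\<close>

definition logistic :: "real \<Rightarrow> real" where
  "logistic t = exp t / (1 + exp t)"

lemma one_plus_exp_pos: "0 < 1 + exp t" for t :: real
  by (simp add: add_pos_pos)

lemma logistic_bounds: "0 \<le> logistic t" "logistic t \<le> 1"
  by (simp_all add: logistic_def add_pos_pos)

lemma has_real_derivative_softplus: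
  "(softplus has_real_derivative logistic t) (at t)"
  unfolding softplus_def[abs_def] logistic_def
  by (auto intro!: derivative_eq_intros simp: one_plus_exp_pos)

lemma has_real_derivative_logistic:
  "(logistic has_real_derivative exp t / (1 + exp t)\<^sup>2) (at t)"
  unfolding logistic_def[abs_def]
  using one_plus_exp_pos[of t]
  by (auto intro!: derivative_eq_intros simp: divide_simps power2_eq_square algebra_simps)

text \<open>
  The derivative of the logistic function is \<open>1 / (1 + 1 + exp t + exp (- t))\<close>, and each of the four
  summands in this denominator is at most \<open>exp \<bar>t\<bar>\<close>.
  This is the origin of the factor \<open>exp (R * L)\<close> in the rate: it is the worst loss of curvature on the
  range of the linear predictors.
\<close>
lemma logistic_derivative_lower_bound:
  fixes t r :: real
  assumes "\<bar>t\<bar> \<le> r"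
  shows "exp (- r) / 4 \<le> exp t / (1 + exp t)\<^sup>2"
proof -
  have "exp (- r) \<le> exp (- \<bar>t\<bar>)"
    using assms by simp
  also have "exp (- \<bar>t\<bar>) * (1 + exp t)\<^sup>2 \<le> 4 * exp t"
  proof (cases "t \<ge> 0")
    case True
    then have "(1 + exp t)\<^sup>2 \<le> (2 * exp t)\<^sup>2"
      by (intro power_mono) (auto simp: add_nonneg_nonneg)
    then have "exp (- t) * (1 + exp t)\<^sup>2 \<le> exp (- t) * (2 * exp t)\<^sup>2"
      by (intro mult_left_mono) auto
    also have "\<dots> = 4 * exp t"
      by (simp add: power2_eq_square exp_minus)
    finally show ?thesis using True by simp
  next
    case False
    then have "(1 + exp t)\<^sup>2 \<le> 2\<^sup>2"
      by (intro power_mono) (auto simp: add_nonneg_nonneg)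
    then have "exp t * (1 + exp t)\<^sup>2 \<le> exp t * 4"
      by (intro mult_left_mono) auto
    then show ?thesis using False by simp
  qed
  then have "exp (- \<bar>t\<bar>) \<le> 4 * (exp t / (1 + exp t)\<^sup>2)"
    using one_plus_exp_pos[of t] by (simp add: pos_le_divide_eq)
  finally show ?thesis by (simp add: mult.commute)
qed

text \<open>
  Second-order Taylor expansion around \<open>a\<close>; the intermediate point stays in \<open>[- r, r]\<close>, where the
  second derivative of softplus is bounded below.
\<close>
lemma softplus_strongly_convex:
  fixes a b r :: real
  assumes "\<bar>a\<bar> \<le> r" "\<bar>b\<bar> \<le> r"
  shows "softplus a + logistic a * (b - a) + exp (- r) / 8 * (b - a)\<^sup>2 \<le> softplus b"
proof (cases "a = b")
  case False
  define diff :: "nat \<Rightarrow> real \<Rightarrow> real" where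
    "diff = (\<lambda>m t. if m = 0 then softplus t else if m = 1 then logistic t
                   else exp t / (1 + exp t)\<^sup>2)"
  have "\<forall>m t. m < 2 \<and> - r \<le> t \<and> t \<le> r \<longrightarrow> DERIV (diff m) t :> diff (Suc m) t"
    using has_real_derivative_softplus has_real_derivative_logistic
    by (auto simp: diff_def less_2_cases_iff)
  moreover have "- r \<le> a" "a \<le> r" "- r \<le> b" "b \<le> r" "b \<noteq> a" "diff 0 = softplus"
    using assms False by (auto simp: diff_def)
  ultimately have "\<exists>t. (if b < a then b < t \<and> t < a else a < t \<and> t < b) \<and>
      softplus b = (\<Sum>m<2. diff m a / fact m * (b - a) ^ m) + diff 2 t / fact 2 * (b - a)\<^sup>2"
    by (intro Taylor[of 2 diff softplus "- r" r a b]) simp_all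
  then obtain t where t: "if b < a then b < t \<and> t < a else a < t \<and> t < b"
    and eq: "softplus b = (\<Sum>m<2. diff m a / fact m * (b - a) ^ m) + diff 2 t / fact 2 * (b - a)\<^sup>2"
    by blast
  have "exp (- r) / 4 \<le> diff 2 t"
    unfolding diff_def using logistic_derivative_lower_bound[of t r] t assms
    by (auto split: if_splits)
  then have "exp (- r) / 8 * (b - a)\<^sup>2 \<le> diff 2 t / 2 * (b - a)\<^sup>2"
    by (intro mult_right_mono) auto
  then show ?thesis
    using eq by (simp add: diff_def numeral_2_eq_2)
qed simp

section \<open>Quadratic forms and the smallest eigenvalue\<close>

lemma outer_mult_vec: "outer v *v w = (v \<bullet> w) *\<^sub>R v"
  by (simp add: vec_eq_iff outer_def matrix_vector_mult_def inner_vec_def sum_distrib_left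
      mult_ac)

text \<open>
  Matrices are vectors too, with the Frobenius inner product. Writing a quadratic form as an inner
  product with \<open>outer v\<close> turns bounds on quadratic forms into Cauchy--Schwarz with the Frobenius norm,
  so that random matrices can be treated by the same Chebyshev bound as random vectors.
\<close>
lemma inner_outer: "outer v \<bullet> S = v \<bullet> (S *v v)"
  by (simp add: outer_def matrix_vector_mult_def inner_vec_def sum_distrib_left mult_ac)

lemma inner_outer_outer: "outer v \<bullet> outer w = (v \<bullet> w)\<^sup>2"
  by (simp add: inner_outer outer_mult_vec power2_eq_square inner_commute)

lemma norm_outer: "norm (outer v) = (norm v)\<^sup>2"
proof -
  have "(norm (outer v))\<^sup>2 = ((norm v)\<^sup>2)\<^sup>2"
    using inner_outer_outer[of v v] by (simp only: power2_norm_eq_inner)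
  then show ?thesis by (rule power2_eq_imp_eq) auto
qed

lemma symmetric_matrix_inner:
  fixes S :: "real^'d^'d"
  assumes "transpose S = S"
  shows "(S *v v) \<bullet> w = v \<bullet> (S *v w)"
proof -
  have "S *v v = v v* S"
    using transpose_matrix_vector[of S v] by (simp only: assms)
  then show ?thesis by (simp only: dot_lmul_matrix)
qed

text \<open>
  Eigenvectors of a symmetric matrix for distinct eigenvalues are orthogonal, hence independent.
  Finiteness is what makes \<open>lambda_min\<close>, a \<open>Min\<close>, a lower bound of the eigenvalues.
\<close>
lemma finite_real_eigenvalues:
  fixes S :: "real^'d^'d"
  assumes sym: "transpose S = S"
  shows "finite {c. \<exists>v. v \<noteq> 0 \<and> S *v v = c *\<^sub>R v}" (is "finite ?E")
proof -
  define ev where "ev c = (SOME v. v \<noteq> 0 \<and> S *v v = c *\<^sub>R v)" for c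
  have ev: "ev c \<noteq> 0 \<and> S *v ev c = c *\<^sub>R ev c" if "c \<in> ?E" for c
  proof -
    have "\<exists>v. v \<noteq> 0 \<and> S *v v = c *\<^sub>R v" using that by blast
    from someI_ex[OF this] show ?thesis unfolding ev_def .
  qed
  note symm = symmetric_matrix_inner[OF sym]
  have orth: "ev c \<bullet> ev e = 0" if "c \<in> ?E" "e \<in> ?E" "c \<noteq> e" for c e
  proof -
    have "c * (ev c \<bullet> ev e) = e * (ev c \<bullet> ev e)"
      using symm[of "ev c" "ev e"] ev[OF that(1)] ev[OF that(2)] by simp
    then show ?thesis using that(3) by simp
  qed
  have inj: "inj_on ev ?E"
  proof (rule inj_onI, rule ccontr)
    fix c e assume ce: "c \<in> ?E" "e \<in> ?E" "ev c = ev e" "c \<noteq> e"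
    then have "ev c \<bullet> ev c = 0"
      using orth[of c e] by simp
    then show False using ev[OF ce(1)] by simp
  qed
  have "independent (ev ` ?E)"
    by (rule pairwise_orthogonal_independent)
       (use orth ev in \<open>fastforce simp: pairwise_def orthogonal_def\<close>)+
  then have "finite (ev ` ?E)"
    by (rule independent_bound[THEN conjunct1])
  then show ?thesis
    using inj by (rule finite_imageD)
qed

text \<open>
  Rayleigh's principle: the minimum \<open>\<mu>\<close> of the quadratic form on the unit sphere is attained, by
  compactness, and a minimiser is an eigenvector with eigenvalue \<open>\<mu>\<close>, so \<open>lambda_min S \<le> \<mu>\<close>.
\<close>
lemma lambda_min_le_quadratic_form:
  fixes S :: "real^'d^'d"
  assumes sym: "transpose S = S"
  shows "lambda_min S * (norm w)\<^sup>2 \<le> w \<bullet> (S *v w)"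
proof -
  note symm = symmetric_matrix_inner[OF sym]
  have "continuous_on (sphere 0 1) (\<lambda>v. v \<bullet> (S *v v))"
    by (intro continuous_intros linear_continuous_on matrix_vector_mul_bounded_linear)
  moreover have "sphere (0::real^'d) 1 \<noteq> {}" by simp
  ultimately obtain v where v: "norm v = 1"
    and vmin: "\<And>u. norm u = 1 \<Longrightarrow> v \<bullet> (S *v v) \<le> u \<bullet> (S *v u)"
    using continuous_attains_inf[of "sphere (0::real^'d) 1" "\<lambda>v. v \<bullet> (S *v v)"]
    by auto
  define \<mu> where "\<mu> = v \<bullet> (S *v v)"
  have quad: "\<mu> * (u \<bullet> u) \<le> u \<bullet> (S *v u)" for u
  proof (cases "u = 0")
    case False
    define z where "z = (1 / norm u) *\<^sub>R u"
    have z: "u = norm u *\<^sub>R z" "norm z = 1"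
      using False by (auto simp: z_def)
    have "u \<bullet> (S *v u) = (norm u)\<^sup>2 * (z \<bullet> (S *v z))"
      by (subst (1 2) z(1)) (simp add: matrix_vector_mult_scaleR power2_eq_square)
    moreover have "\<mu> * (norm u)\<^sup>2 \<le> (norm u)\<^sup>2 * (z \<bullet> (S *v z))"
      using mult_right_mono[OF vmin[OF z(2)], of "(norm u)\<^sup>2"] by (simp add: \<mu>_def mult.commute)
    ultimately show ?thesis by (simp add: power2_norm_eq_inner)
  qed simp
  \<comment> \<open>If the gradient \<open>y\<close> of the form \<open>u \<mapsto> u \<bullet> (S *v u) - \<mu> * (u \<bullet> u)\<close> at \<open>v\<close> did not vanish,
      a small step from \<open>v\<close> in the direction \<open>- y\<close> would make the form negative.\<close>
  have eig: "S *v v = \<mu> *\<^sub>R v"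
  proof (rule ccontr)
    assume neq: "S *v v \<noteq> \<mu> *\<^sub>R v"
    define y where "y = S *v v - \<mu> *\<^sub>R v"
    define g where "g = y \<bullet> y"
    define h where "h = y \<bullet> (S *v y) - \<mu> * (y \<bullet> y)"
    have g: "g > 0" using neq by (simp add: g_def y_def)
    have h: "h \<ge> 0" using quad[of y] by (simp add: h_def)
    have *: "0 \<le> 2 * t * g + t\<^sup>2 * h" for t
    proof -
      have "0 \<le> (v + t *\<^sub>R y) \<bullet> (S *v (v + t *\<^sub>R y)) - \<mu> * ((v + t *\<^sub>R y) \<bullet> (v + t *\<^sub>R y))"
        using quad[of "v + t *\<^sub>R y"] by simp
      also have "\<dots> = (v \<bullet> (S *v v) - \<mu> * (v \<bullet> v))
            + t * (y \<bullet> (S *v v) + v \<bullet> (S *v y) - 2 * \<mu> * (y \<bullet> v)) + t\<^sup>2 * h"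
        by (simp add: h_def matrix_vector_right_distrib matrix_vector_mult_scaleR
            inner_add_left inner_add_right power2_eq_square algebra_simps inner_commute[of v y])
      also have "v \<bullet> (S *v v) - \<mu> * (v \<bullet> v) = 0"
        using v by (simp add: \<mu>_def norm_eq_1)
      also have "v \<bullet> (S *v y) = y \<bullet> (S *v v)"
        using symm[of v y] by (simp add: inner_commute)
      also have "y \<bullet> (S *v v) + y \<bullet> (S *v v) - 2 * \<mu> * (y \<bullet> v) = 2 * g"
        by (simp add: g_def y_def inner_diff_right algebra_simps)
      finally show ?thesis by (simp add: algebra_simps)
    qed
    have "2 * (- g / (h + 1)) * g + (- g / (h + 1))\<^sup>2 * h
        = g\<^sup>2 / (h + 1) * (h / (h + 1) - 2)"
      using h by (simp add: divide_simps power2_eq_square) (simp add: algebra_simps)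
    also have "\<dots> < 0"
      using g h by (intro mult_pos_neg) (auto simp: divide_simps)
    finally show False using *[of "- g / (h + 1)"] by simp
  qed
  have "lambda_min S \<le> \<mu>"
    unfolding lambda_min_def
    by (rule Min_le[OF finite_real_eigenvalues[OF sym]]) (use eig v in \<open>auto intro!: exI[of _ v]\<close>)
  then have "lambda_min S * (norm w)\<^sup>2 \<le> \<mu> * (norm w)\<^sup>2"
    by (intro mult_right_mono) auto
  then show ?thesis
    using quad[of w] by (simp add: power2_norm_eq_inner)
qed

section \<open>Product laws on finite sets\<close>

text \<open>
  Independence of the blocks enters only through product weights on a finite product of finite sets,
  so expectations are finite sums.
\<close>
locale finite_product_law =
  fixes I :: "'i set" and S :: "'i \<Rightarrow> 'a set" and q :: "'i \<Rightarrow> 'a \<Rightarrow> real"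
  assumes finite_index: "finite I"
    and finite_state: "i \<in> I \<Longrightarrow> finite (S i)"
    and q_nonneg: "\<lbrakk>i \<in> I; y \<in> S i\<rbrakk> \<Longrightarrow> 0 \<le> q i y"
    and q_sum: "i \<in> I \<Longrightarrow> (\<Sum>y\<in>S i. q i y) = 1"
begin

definition mass :: "('i \<Rightarrow> 'a) \<Rightarrow> real" where
  "mass x = (\<Prod>i\<in>I. q i (x i))"

definition event_prob :: "(('i \<Rightarrow> 'a) \<Rightarrow> bool) \<Rightarrow> real" where
  "event_prob Q = (\<Sum>x\<in>{x \<in> PiE I S. Q x}. mass x)"

lemma finite_states: "finite (PiE I S)"
  using finite_index finite_state by (rule finite_PiE)

lemma mass_nonneg: "x \<in> PiE I S \<Longrightarrow> 0 \<le> mass x"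
  unfolding mass_def by (intro prod_nonneg q_nonneg) (auto simp: PiE_mem)

text \<open>
  Expectations of products of functions of single coordinates factorise; marginals and orthogonality
  below are instances in which all but one or two factors are \<open>1\<close>.
\<close>
lemma sum_mass_prod:
  "(\<Sum>x\<in>PiE I S. mass x * (\<Prod>i\<in>I. f i (x i))) = (\<Prod>i\<in>I. \<Sum>y\<in>S i. q i y * f i y)"
  by (subst prod_sum_PiE) (auto simp: finite_index finite_state mass_def prod.distrib)

lemma sum_mass: "(\<Sum>x\<in>PiE I S. mass x) = 1"
  using sum_mass_prod[of "\<lambda>_ _. 1"] by (simp add: q_sum)

lemma expectation_marginal_real:
  fixes f :: "'a \<Rightarrow> real"
  assumes "i \<in> I"
  shows "(\<Sum>x\<in>PiE I S. mass x * f (x i)) = (\<Sum>y\<in>S i. q i y * f y)"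
proof -
  have "(\<Sum>x\<in>PiE I S. mass x * f (x i))
      = (\<Sum>x\<in>PiE I S. mass x * (\<Prod>p\<in>I. if p = i then f (x p) else 1))"
    using assms finite_index by (simp add: prod.delta)
  also have "\<dots> = (\<Prod>p\<in>I. \<Sum>y\<in>S p. q p y * (if p = i then f y else 1))"
    by (rule sum_mass_prod)
  also have "\<dots> = (\<Prod>p\<in>I. if p = i then \<Sum>y\<in>S i. q i y * f y else 1)"
    by (intro prod.cong) (auto simp: q_sum)
  finally show ?thesis using assms finite_index by (simp add: prod.delta)
qed

lemma expectation_marginal:
  fixes f :: "'a \<Rightarrow> 'b :: euclidean_space"
  assumes "i \<in> I"
  shows "(\<Sum>x\<in>PiE I S. mass x *\<^sub>R f (x i)) = (\<Sum>y\<in>S i. q i y *\<^sub>R f y)"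
proof (rule euclidean_eqI)
  fix b :: 'b
  show "(\<Sum>x\<in>PiE I S. mass x *\<^sub>R f (x i)) \<bullet> b = (\<Sum>y\<in>S i. q i y *\<^sub>R f y) \<bullet> b"
    using expectation_marginal_real[OF assms, of "\<lambda>y. f y \<bullet> b"] by (simp add: inner_sum_left)
qed

lemma expectation_inner_eq_0:
  fixes f g :: "'a \<Rightarrow> 'b :: euclidean_space"
  assumes "i \<in> I" "j \<in> I" "i \<noteq> j" and zero: "(\<Sum>y\<in>S j. q j y *\<^sub>R g y) = 0"
  shows "(\<Sum>x\<in>PiE I S. mass x * (f (x i) \<bullet> g (x j))) = 0"
proof -
  have "(\<Sum>x\<in>PiE I S. mass x * ((f (x i) \<bullet> b) * (g (x j) \<bullet> b))) = 0" for b
  proof -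
    let ?h = "\<lambda>p y. if p = i then f y \<bullet> b else if p = j then g y \<bullet> b else 1"
    have "(\<Prod>p\<in>I. ?h p (x p)) = (f (x i) \<bullet> b) * (g (x j) \<bullet> b)" for x
    proof -
      have "(\<Prod>p\<in>I. ?h p (x p)) = (\<Prod>p\<in>{i, j}. ?h p (x p))"
        using assms(1,2) finite_index by (intro prod.mono_neutral_right) auto
      then show ?thesis using assms(3) by simp
    qed
    then have "(\<Sum>x\<in>PiE I S. mass x * ((f (x i) \<bullet> b) * (g (x j) \<bullet> b)))
        = (\<Prod>p\<in>I. \<Sum>y\<in>S p. q p y * ?h p y)"
      using sum_mass_prod[of ?h] by simp
    also have "\<dots> = 0"
    proof (rule prod_zero[OF finite_index], rule bexI[OF _ assms(2)])
      have "(\<Sum>y\<in>S j. q j y * ?h j y) = (\<Sum>y\<in>S j. q j y *\<^sub>R g y) \<bullet> b"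
        using assms(3) by (simp add: inner_sum_left)
      then show "(\<Sum>y\<in>S j. q j y * ?h j y) = 0" by (simp only: zero inner_zero_left)
    qed
    finally show ?thesis .
  qed
  then have "0 = (\<Sum>b\<in>Basis. \<Sum>x\<in>PiE I S. mass x * ((f (x i) \<bullet> b) * (g (x j) \<bullet> b)))"
    by simp
  also have "\<dots> = (\<Sum>x\<in>PiE I S. \<Sum>b\<in>Basis. mass x * ((f (x i) \<bullet> b) * (g (x j) \<bullet> b)))"
    by (rule sum.swap)
  also have "\<dots> = (\<Sum>x\<in>PiE I S. mass x * (f (x i) \<bullet> g (x j)))"
    by (intro sum.cong refl) (subst euclidean_inner, simp only: sum_distrib_left)
  finally show ?thesis by simp
qed

text \<open>
  The cross terms vanish by independence, so the second moment grows like \<open>card J\<close> instead of its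
  square. This is the source of the factor \<open>1 / sqrt K\<close> in the rate.
\<close>
lemma second_moment_sum_le:
  fixes Y :: "'i \<Rightarrow> 'a \<Rightarrow> 'b :: euclidean_space"
  assumes J: "J \<subseteq> I"
    and zero: "\<And>j. j \<in> J \<Longrightarrow> (\<Sum>y\<in>S j. q j y *\<^sub>R Y j y) = 0"
    and bound: "\<And>j y. \<lbrakk>j \<in> J; y \<in> S j\<rbrakk> \<Longrightarrow> norm (Y j y) \<le> b"
  shows "(\<Sum>x\<in>PiE I S. mass x * (norm (\<Sum>j\<in>J. Y j (x j)))\<^sup>2) \<le> real (card J) * b\<^sup>2"
proof -
  have finJ: "finite J" using J finite_index by (rule finite_subset)
  have "(\<Sum>x\<in>PiE I S. mass x * (norm (\<Sum>j\<in>J. Y j (x j)))\<^sup>2)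
      = (\<Sum>x\<in>PiE I S. \<Sum>i\<in>J. \<Sum>j\<in>J. mass x * (Y i (x i) \<bullet> Y j (x j)))"
    by (simp only: power2_norm_eq_inner inner_sum_left) (simp only: inner_sum_right sum_distrib_left)
  also have "\<dots> = (\<Sum>i\<in>J. \<Sum>j\<in>J. \<Sum>x\<in>PiE I S. mass x * (Y i (x i) \<bullet> Y j (x j)))"
    by (subst sum.swap, rule sum.cong[OF refl], rule sum.swap)
  also have "\<dots> = (\<Sum>i\<in>J. \<Sum>j\<in>J. if j = i then \<Sum>x\<in>PiE I S. mass x * (norm (Y i (x i)))\<^sup>2 else 0)"
    using J zero
    by (intro sum.cong refl) (auto simp: power2_norm_eq_inner intro!: expectation_inner_eq_0)
  also have "\<dots> = (\<Sum>i\<in>J. \<Sum>x\<in>PiE I S. mass x * (norm (Y i (x i)))\<^sup>2)"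
    using finJ by simp
  also have "\<dots> \<le> (\<Sum>i\<in>J. \<Sum>x\<in>PiE I S. mass x * b\<^sup>2)"
    using J by (intro sum_mono mult_left_mono mass_nonneg power_mono bound norm_ge_zero) (auto simp: PiE_mem)
  also have "\<dots> = real (card J) * b\<^sup>2"
    by (simp add: sum_mass flip: sum_distrib_right)
  finally show ?thesis .
qed

lemma event_prob_mono:
  assumes "\<And>x. \<lbrakk>x \<in> PiE I S; Q x\<rbrakk> \<Longrightarrow> R x"
  shows "event_prob Q \<le> event_prob R"
  unfolding event_prob_def
proof (rule sum_mono2)
  show "finite {x \<in> PiE I S. R x}" using finite_states by simp
  show "{x \<in> PiE I S. Q x} \<subseteq> {x \<in> PiE I S. R x}" using assms by blast
qed (blast intro: mass_nonneg)

lemma event_prob_union: "event_prob (\<lambda>x. Q x \<or> R x) \<le> event_prob Q + event_prob R"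
proof -
  have "{x \<in> PiE I S. Q x \<or> R x} = {x \<in> PiE I S. Q x} \<union> {x \<in> PiE I S. R x}" by blast
  moreover have "0 \<le> sum mass ({x \<in> PiE I S. Q x} \<inter> {x \<in> PiE I S. R x})"
    by (rule sum_nonneg) (blast intro: mass_nonneg)
  ultimately show ?thesis
    unfolding event_prob_def using finite_states by (simp add: sum_Un)
qed

lemma event_prob_compl: "event_prob Q = 1 - event_prob (\<lambda>x. \<not> Q x)"
proof -
  have "event_prob Q + event_prob (\<lambda>x. \<not> Q x)
      = (\<Sum>x\<in>{x \<in> PiE I S. Q x} \<union> {x \<in> PiE I S. \<not> Q x}. mass x)"
    unfolding event_prob_def using finite_states by (intro sum.union_disjoint[symmetric]) auto
  also have "{x \<in> PiE I S. Q x} \<union> {x \<in> PiE I S. \<not> Q x} = PiE I S" by blast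
  finally show ?thesis using sum_mass by simp
qed

lemma chebyshev_sum:
  fixes Y :: "'i \<Rightarrow> 'a \<Rightarrow> 'b :: euclidean_space"
  assumes "J \<subseteq> I"
    and "\<And>j. j \<in> J \<Longrightarrow> (\<Sum>y\<in>S j. q j y *\<^sub>R Y j y) = 0"
    and "\<And>j y. \<lbrakk>j \<in> J; y \<in> S j\<rbrakk> \<Longrightarrow> norm (Y j y) \<le> b"
    and "a > 0"
  shows "event_prob (\<lambda>x. a < norm (\<Sum>j\<in>J. Y j (x j))) \<le> real (card J) * b\<^sup>2 / a\<^sup>2"
proof -
  have "a\<^sup>2 * event_prob (\<lambda>x. a < norm (\<Sum>j\<in>J. Y j (x j)))
      = (\<Sum>x\<in>{x \<in> PiE I S. a < norm (\<Sum>j\<in>J. Y j (x j))}. mass x * a\<^sup>2)"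
    by (simp add: event_prob_def sum_distrib_left mult.commute)
  also have "\<dots> \<le> (\<Sum>x\<in>{x \<in> PiE I S. a < norm (\<Sum>j\<in>J. Y j (x j))}.
                      mass x * (norm (\<Sum>j\<in>J. Y j (x j)))\<^sup>2)"
    using \<open>a > 0\<close> by (intro sum_mono mult_left_mono mass_nonneg power_mono) simp_all
  also have "\<dots> \<le> (\<Sum>x\<in>PiE I S. mass x * (norm (\<Sum>j\<in>J. Y j (x j)))\<^sup>2)"
    using finite_states by (intro sum_mono2) (auto intro!: mult_nonneg_nonneg mass_nonneg)
  also have "\<dots> \<le> real (card J) * b\<^sup>2"
    by (rule second_moment_sum_le) (use assms in auto)
  finally have "event_prob (\<lambda>x. a < norm (\<Sum>j\<in>J. Y j (x j))) * a\<^sup>2 \<le> real (card J) * b\<^sup>2"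
    by (subst mult.commute)
  then show ?thesis
    using \<open>a > 0\<close> by (intro mult_imp_le_div_pos) simp_all
qed

end

section \<open>Logistic regression on independent blocks\<close>

lemma logistic_loss_lower_bound:
  fixes b \<beta> v :: "'b :: euclidean_space"
  assumes "norm b \<le> R" "norm \<beta> \<le> R" "norm v \<le> L"
  shows "(softplus (\<beta> \<bullet> v) - r * (\<beta> \<bullet> v)) + (logistic (\<beta> \<bullet> v) - r) * ((b - \<beta>) \<bullet> v)
           + exp (- (R * L)) / 8 * ((b - \<beta>) \<bullet> v)\<^sup>2
         \<le> softplus (b \<bullet> v) - r * (b \<bullet> v)"
proof -
  have "\<bar>w \<bullet> v\<bar> \<le> R * L" if "norm w \<le> R" for w
    using Cauchy_Schwarz_ineq2[of w v] mult_mono'[OF that assms(3)] by simp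
  from softplus_strongly_convex[OF this[OF assms(2)] this[OF assms(1)]]
  show ?thesis by (simp add: inner_diff_left algebra_simps)
qed

context finite_product_law
begin

text \<open>
  A logistic regression with \<open>N = card J\<close> independent blocks of observations, design vectors
  \<open>v j m y\<close> and responses \<open>r j m y\<close>; within a block the observations may depend on each other
  arbitrarily.

  Let \<open>\<delta>\<close> be the error of the minimiser, \<open>g\<close> the score at \<open>\<beta>\<close> and \<open>H\<close> the sum of all \<open>outer v\<close>.
  The loss at the minimiser does not exceed the loss at \<open>\<beta>\<close>, so strong convexity gives
  \<open>exp (- R * L) / 8 * (\<delta> \<bullet> H \<delta>) \<le> norm g * norm \<delta>\<close>. By Chebyshev, \<open>norm g\<close> is of
  order \<open>D * L * sqrt N\<close>, and \<open>H\<close> is within \<open>N * \<xi> / 2\<close> of its mean, which is at least \<open>N * \<xi>\<close>;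
  dividing gives the claim. The second application of Chebyshev needs \<open>N\<close> to be large compared with
  \<open>P * D\<^sup>2 * L ^ 4 / \<xi>\<^sup>2\<close>. For smaller \<open>N\<close> the asserted bound is at least the diameter \<open>2 * R\<close> of the
  ball and holds trivially; here the exponential factor pays for the additional power of \<open>L\<close>, as
  \<open>R * L \<le> exp (R * L)\<close>.
\<close>
lemma logistic_minimiser_deviation:
  fixes v :: "'i \<Rightarrow> 'm \<Rightarrow> 'a \<Rightarrow> real^'d" and r :: "'i \<Rightarrow> 'm \<Rightarrow> 'a \<Rightarrow> real"
    and hat :: "('i \<Rightarrow> 'a) \<Rightarrow> real^'d"
    and J :: "'i set" and E :: "'i \<Rightarrow> 'm set"
  defines "loss \<equiv> \<lambda>x b. \<Sum>j\<in>J. \<Sum>m\<in>E j. softplus (b \<bullet> v j m (x j)) - r j m (x j) * (b \<bullet> v j m (x j))"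
  assumes J: "J \<subseteq> I" "J \<noteq> {}"
    and E: "\<And>j. j \<in> J \<Longrightarrow> real (card (E j)) \<le> D"
    and L: "0 \<le> L" "\<And>j m y. \<lbrakk>j \<in> J; m \<in> E j; y \<in> S j\<rbrakk> \<Longrightarrow> norm (v j m y) \<le> L"
    and r: "\<And>j m y. \<lbrakk>j \<in> J; m \<in> E j; y \<in> S j\<rbrakk> \<Longrightarrow> r j m y \<in> {0..1}"
    and score: "\<And>j. j \<in> J \<Longrightarrow>
      (\<Sum>y\<in>S j. q j y *\<^sub>R (\<Sum>m\<in>E j. (logistic (\<beta> \<bullet> v j m y) - r j m y) *\<^sub>R v j m y)) = 0"
    and \<xi>: "0 < \<xi>" "\<And>j u. j \<in> J \<Longrightarrow>
      \<xi> * (norm u)\<^sup>2 \<le> (\<Sum>y\<in>S j. q j y * (\<Sum>m\<in>E j. (u \<bullet> v j m y)\<^sup>2))"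
    and R: "0 < R" "norm \<beta> \<le> R"
    and P: "1 \<le> P"
    and hat: "\<And>x. x \<in> PiE I S \<Longrightarrow> norm (hat x) \<le> R"
      "\<And>x. x \<in> PiE I S \<Longrightarrow> loss x (hat x) \<le> loss x \<beta>"
  shows "event_prob (\<lambda>x. 32 * sqrt P * D * L * exp (R * L) / (\<xi> * sqrt (real (card J))) < norm (hat x - \<beta>))
           \<le> 1 / (2 * P)"
proof -
  define N where "N = real (card J)"
  define B where "B = 32 * sqrt P * D * L * exp (R * L) / (\<xi> * sqrt N)"
  have finJ: "finite J" using J finite_index by (auto intro: finite_subset)
  have N: "N \<ge> 1" using finJ J by (simp add: N_def Suc_le_eq card_gt_0_iff)
  have x_state: "x j \<in> S j" if "x \<in> PiE I S" "j \<in> J" for x j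
    using that J by (auto simp: PiE_mem)
  have sum_edges: "(\<Sum>m\<in>E j. f m) \<le> D * c" if "j \<in> J" "0 \<le> c" "\<And>m. m \<in> E j \<Longrightarrow> f m \<le> c"
    for j f and c :: real
  proof -
    have "(\<Sum>m\<in>E j. f m) \<le> real (card (E j)) * c"
      using that(3) by (rule sum_bounded_above)
    also have "\<dots> \<le> D * c" using E[OF that(1)] that(2) by (rule mult_right_mono)
    finally show ?thesis .
  qed
  define H where "H j y = (\<Sum>m\<in>E j. outer (v j m y))" for j y
  define Hbar where "Hbar j = (\<Sum>y\<in>S j. q j y *\<^sub>R H j y)" for j
  define g where "g j y = (\<Sum>m\<in>E j. (logistic (\<beta> \<bullet> v j m y) - r j m y) *\<^sub>R v j m y)" for j y
  have outer_H: "outer u \<bullet> H j y = (\<Sum>m\<in>E j. (u \<bullet> v j m y)\<^sup>2)" for u j y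
    by (simp add: H_def inner_sum_right inner_outer_outer)
  have outer_Hbar: "\<xi> * (norm u)\<^sup>2 \<le> outer u \<bullet> Hbar j" if "j \<in> J" for u j
    using \<xi>(2)[OF that, of u] by (simp add: Hbar_def inner_sum_right outer_H)
  have norm_H: "norm (H j y) \<le> D * L\<^sup>2" if "j \<in> J" "y \<in> S j" for j y
    unfolding H_def
    by (rule order_trans[OF norm_sum sum_edges[OF that(1)]])
       (auto simp: norm_outer intro!: power_mono L(2) that)
  have norm_Hbar: "norm (Hbar j) \<le> D * L\<^sup>2" if "j \<in> J" for j
  proof -
    have "norm (Hbar j) \<le> (\<Sum>y\<in>S j. norm (q j y *\<^sub>R H j y))"
      unfolding Hbar_def by (rule norm_sum)
    also have "\<dots> \<le> (\<Sum>y\<in>S j. q j y * (D * L\<^sup>2))"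
      using J that by (intro sum_mono) (auto simp: q_nonneg subset_iff intro!: mult_left_mono norm_H)
    also have "\<dots> = D * L\<^sup>2"
      using J that by (simp add: q_sum subset_iff flip: sum_distrib_right)
    finally show ?thesis .
  qed
  have norm_g: "norm (g j y) \<le> D * L" if "j \<in> J" "y \<in> S j" for j y
    unfolding g_def
  proof (rule order_trans[OF norm_sum sum_edges[OF that(1) L(1)]])
    fix m assume m: "m \<in> E j"
    have "\<bar>logistic (\<beta> \<bullet> v j m y) - r j m y\<bar> \<le> 1"
      using logistic_bounds[of "\<beta> \<bullet> v j m y"] r[OF that(1) m that(2)] by auto
    then have "\<bar>logistic (\<beta> \<bullet> v j m y) - r j m y\<bar> * norm (v j m y) \<le> 1 * L"
      using L(2)[OF that(1) m that(2)] by (intro mult_mono') auto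
    then show "norm ((logistic (\<beta> \<bullet> v j m y) - r j m y) *\<^sub>R v j m y) \<le> L" by simp
  qed
  \<comment> \<open>Positive information forces nonempty edge sets and nonzero design vectors.\<close>
  have DL: "0 < D" "0 < L"
  proof -
    obtain j where j: "j \<in> J" using J by auto
    fix i :: 'd
    have "\<xi> \<le> outer (axis i 1) \<bullet> Hbar j"
      using outer_Hbar[OF j, of "axis i 1"] by simp
    also have "\<dots> \<le> norm (Hbar j)"
      using norm_cauchy_schwarz[of "outer (axis i 1)" "Hbar j"] by (simp add: norm_outer)
    also note norm_Hbar[OF j]
    finally have *: "0 < D * L\<^sup>2" using \<xi> by simp
    then show "0 < L" using L(1) by (cases "L = 0") auto
    then show "0 < D" using * by (simp add: zero_less_mult_iff)
  qed
  have B0: "0 \<le> B" using DL \<xi> N P by (simp add: B_def)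
  have triv: "norm (hat x - \<beta>) \<le> 2 * R" if "x \<in> PiE I S" for x
    using hat(1)[OF that] R(2) norm_triangle_ineq4[of "hat x" \<beta>] by simp
  show ?thesis
  proof (cases "64 * P * D\<^sup>2 * L ^ 4 / \<xi>\<^sup>2 \<le> N")
    case False
    have "N \<le> 64 * P * D\<^sup>2 * L ^ 4 / \<xi>\<^sup>2" using False by simp
    also have "\<dots> = (8 * sqrt P * D * L\<^sup>2 / \<xi>)\<^sup>2"
      using P by (simp add: power_divide power_mult_distrib)
    finally have "sqrt N \<le> 8 * sqrt P * D * L\<^sup>2 / \<xi>"
      using DL \<xi> P by (intro real_le_lsqrt) auto
    then have sN: "\<xi> * sqrt N \<le> 8 * sqrt P * D * L\<^sup>2"
      using \<xi> by (simp add: field_simps)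
    have "R * L \<le> exp (R * L)" using exp_ge_add_one_self[of "R * L"] by linarith
    then have RL: "16 * sqrt P * D * L * (R * L) \<le> 16 * sqrt P * D * L * exp (R * L)"
      using DL P by (intro mult_left_mono) auto
    have "2 * R * (\<xi> * sqrt N) \<le> 2 * R * (8 * sqrt P * D * L\<^sup>2)"
      using sN R by (intro mult_left_mono) auto
    also have "\<dots> = 16 * sqrt P * D * L * (R * L)"
      by (simp add: power2_eq_square)
    also note RL
    also have "16 * sqrt P * D * L * exp (R * L) \<le> 32 * sqrt P * D * L * exp (R * L)"
      using DL P by (intro mult_right_mono) auto
    finally have "2 * R \<le> B"
      unfolding B_def using \<xi> N by (simp add: pos_le_divide_eq)
    then have "event_prob (\<lambda>x. B < norm (hat x - \<beta>)) \<le> event_prob (\<lambda>_. False)"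
      using triv by (intro event_prob_mono) fastforce
    also have "\<dots> \<le> 1 / (2 * P)" using P by (simp add: event_prob_def)
    finally show ?thesis by (simp add: B_def N_def)
  next
    case True
    \<comment> \<open>The threshold that makes the Chebyshev bound for the score \<open>1 / (4 * P)\<close>; the other half of
        the budget \<open>1 / (2 * P)\<close> goes to the information matrix.\<close>
    define a where "a = 2 * sqrt P * sqrt N * D * L"
    have a: "a > 0" using DL P N by (simp add: a_def)
    define W where "W j y = H j y - Hbar j" for j y
    have W0: "(\<Sum>y\<in>S j. q j y *\<^sub>R W j y) = 0" if "j \<in> J" for j
      using J that
      by (auto simp: W_def scaleR_diff_right sum_subtractf q_sum subset_iff simp flip: Hbar_def scaleR_sum_left)
    have norm_W: "norm (W j y) \<le> 2 * (D * L\<^sup>2)" if "j \<in> J" "y \<in> S j" for j y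
      using norm_triangle_ineq4[of "H j y" "Hbar j"] norm_H[OF that] norm_Hbar[OF that(1)]
      by (simp add: W_def)
    have "event_prob (\<lambda>x. a < norm (\<Sum>j\<in>J. g j (x j))) \<le> N * (D * L)\<^sup>2 / a\<^sup>2"
      unfolding N_def using J(1) score norm_g a by (intro chebyshev_sum) (auto simp: g_def)
    also have "\<dots> = 1 / (4 * P)"
      using DL P N by (simp add: a_def power_mult_distrib field_simps)
    finally have prob_g: "event_prob (\<lambda>x. a < norm (\<Sum>j\<in>J. g j (x j))) \<le> 1 / (4 * P)" .
    have "event_prob (\<lambda>x. N * \<xi> / 2 < norm (\<Sum>j\<in>J. W j (x j))) \<le> N * (2 * (D * L\<^sup>2))\<^sup>2 / (N * \<xi> / 2)\<^sup>2"
      unfolding N_def using J(1) W0 norm_W N \<xi> by (intro chebyshev_sum) (auto simp: N_def)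
    also have "\<dots> = 16 * D\<^sup>2 * L ^ 4 / (N * \<xi>\<^sup>2)"
      using N \<xi>(1) by (simp add: power2_eq_square power4_eq_xxxx divide_simps)
    also have "\<dots> \<le> 1 / (4 * P)"
      using True N \<xi>(1) P by (simp add: divide_simps mult_ac)
    finally have prob_W: "event_prob (\<lambda>x. N * \<xi> / 2 < norm (\<Sum>j\<in>J. W j (x j))) \<le> 1 / (4 * P)" .
    have "norm (hat x - \<beta>) \<le> B"
      if x: "x \<in> PiE I S" and gx: "norm (\<Sum>j\<in>J. g j (x j)) \<le> a"
        and Wx: "norm (\<Sum>j\<in>J. W j (x j)) \<le> N * \<xi> / 2" for x
    proof (cases "hat x = \<beta>")
      case False
      define \<delta> where "\<delta> = hat x - \<beta>"
      have \<delta>: "norm \<delta> > 0" using False by (simp add: \<delta>_def)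
      define c where "c = exp (- (R * L)) / 8"
      let ?Q = "\<Sum>j\<in>J. \<Sum>m\<in>E j. (\<delta> \<bullet> v j m (x j))\<^sup>2"
      have "loss x \<beta> + (\<Sum>j\<in>J. g j (x j)) \<bullet> \<delta> + c * ?Q
          = (\<Sum>j\<in>J. \<Sum>m\<in>E j. (softplus (\<beta> \<bullet> v j m (x j)) - r j m (x j) * (\<beta> \<bullet> v j m (x j)))
              + (logistic (\<beta> \<bullet> v j m (x j)) - r j m (x j)) * (\<delta> \<bullet> v j m (x j))
              + c * (\<delta> \<bullet> v j m (x j))\<^sup>2)"
        by (simp add: loss_def g_def sum.distrib inner_sum_left sum_distrib_left
            inner_commute[of \<delta>])
      also have "\<dots> \<le> loss x (hat x)"
        unfolding loss_def c_def \<delta>_def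
        by (intro sum_mono logistic_loss_lower_bound hat(1)[OF x] R(2) L(2) x_state[OF x])
      also have "\<dots> \<le> loss x \<beta>" by (rule hat(2)[OF x])
      finally have "c * ?Q \<le> - ((\<Sum>j\<in>J. g j (x j)) \<bullet> \<delta>)" by simp
      also have "\<dots> \<le> norm (\<Sum>j\<in>J. g j (x j)) * norm \<delta>"
        using Cauchy_Schwarz_ineq2[of "\<Sum>j\<in>J. g j (x j)" \<delta>] by linarith
      also have "\<dots> \<le> a * norm \<delta>"
        using gx by (intro mult_right_mono) auto
      finally have upper: "c * ?Q \<le> a * norm \<delta>" .
      have "N * (\<xi> * (norm \<delta>)\<^sup>2) \<le> (\<Sum>j\<in>J. outer \<delta> \<bullet> Hbar j)"
        unfolding N_def using outer_Hbar by (intro sum_bounded_below) auto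
      also have "\<dots> = ?Q - outer \<delta> \<bullet> (\<Sum>j\<in>J. W j (x j))"
        by (simp add: W_def inner_sum_right inner_diff_right sum_subtractf outer_H)
      also have "\<dots> \<le> ?Q + norm (outer \<delta>) * norm (\<Sum>j\<in>J. W j (x j))"
        using Cauchy_Schwarz_ineq2[of "outer \<delta>" "\<Sum>j\<in>J. W j (x j)"] by linarith
      also have "norm (outer \<delta>) * norm (\<Sum>j\<in>J. W j (x j)) \<le> (norm \<delta>)\<^sup>2 * (N * \<xi> / 2)"
        unfolding norm_outer using Wx by (intro mult_left_mono) auto
      finally have "N * \<xi> / 2 * (norm \<delta>)\<^sup>2 \<le> ?Q" by (simp add: algebra_simps)
      then have "c * (N * \<xi> / 2 * (norm \<delta>)\<^sup>2) \<le> c * ?Q"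
        by (intro mult_left_mono) (auto simp: c_def)
      then have "(c * (N * \<xi> / 2) * norm \<delta>) * norm \<delta> \<le> a * norm \<delta>"
        using upper by (simp add: power2_eq_square mult_ac)
      then have "c * (N * \<xi> / 2) * norm \<delta> \<le> a"
        using \<delta> by simp
      then have "norm \<delta> \<le> a / (c * (N * \<xi> / 2))"
        using N \<xi>(1) by (simp add: pos_le_divide_eq c_def mult_ac)
      also have "\<dots> = 32 * sqrt P * D * L * exp (R * L) * (sqrt N / (N * \<xi>))"
        by (simp add: a_def c_def exp_minus field_simps)
      also have "sqrt N / (N * \<xi>) = 1 / (\<xi> * sqrt N)"
        using N \<xi>(1) by (simp add: divide_simps)
      finally show ?thesis by (simp add: \<delta>_def B_def)
    qed (simp add: B0)
    then have "event_prob (\<lambda>x. B < norm (hat x - \<beta>))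
        \<le> event_prob (\<lambda>x. a < norm (\<Sum>j\<in>J. g j (x j)) \<or> N * \<xi> / 2 < norm (\<Sum>j\<in>J. W j (x j)))"
      by (intro event_prob_mono) (meson not_less)
    also have "\<dots> \<le> event_prob (\<lambda>x. a < norm (\<Sum>j\<in>J. g j (x j)))
        + event_prob (\<lambda>x. N * \<xi> / 2 < norm (\<Sum>j\<in>J. W j (x j)))"
      by (rule event_prob_union)
    also have "\<dots> \<le> 1 / (4 * P) + 1 / (4 * P)"
      using prob_g prob_W by (rule add_mono)
    also have "\<dots> = 1 / (2 * P)" by simp
    finally show ?thesis by (simp add: B_def N_def)
  qed
qed

end

section \<open>Transfer from a probability space\<close>

context finite_product_law
begin

lemma measure_eq_event_prob:
  assumes "prob_space M" and X: "X \<in> measurable M (count_space (PiE I S))"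
    and law: "\<And>x. x \<in> PiE I S \<Longrightarrow> measure M {\<omega> \<in> space M. X \<omega> = x} = mass x"
  shows "measure M {\<omega> \<in> space M. Q (X \<omega>)} = event_prob Q"
proof -
  interpret prob_space M by fact
  have "{\<omega> \<in> space M. Q (X \<omega>)} = (\<Union>x\<in>{x \<in> PiE I S. Q x}. {\<omega> \<in> space M. X \<omega> = x})"
    using measurable_space[OF X] by auto
  also have "measure M \<dots> = (\<Sum>x\<in>{x \<in> PiE I S. Q x}. measure M {\<omega> \<in> space M. X \<omega> = x})"
  proof (rule finite_measure_finite_Union)
    have "{\<omega> \<in> space M. X \<omega> = x} = X -` {x} \<inter> space M" for x by auto
    then show "(\<lambda>x. {\<omega> \<in> space M. X \<omega> = x}) ` {x \<in> PiE I S. Q x} \<subseteq> sets M"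
      using measurable_sets[OF X] by auto
  qed (auto simp: finite_states disjoint_family_on_def)
  also have "\<dots> = event_prob Q"
    unfolding event_prob_def using law by (intro sum.cong) auto
  finally show ?thesis .
qed

lemma integral_marginal:
  fixes f :: "'a \<Rightarrow> 'b :: euclidean_space"
  assumes "prob_space M" and X: "X \<in> measurable M (count_space (PiE I S))"
    and law: "\<And>x. x \<in> PiE I S \<Longrightarrow> measure M {\<omega> \<in> space M. X \<omega> = x} = mass x"
    and i: "i \<in> I"
  shows "(\<integral>\<omega>. f (X \<omega> i) \<partial>M) = (\<Sum>y\<in>S i. q i y *\<^sub>R f y)"
proof -
  interpret prob_space M by fact
  have sets: "{\<omega> \<in> space M. X \<omega> = x} \<in> sets M" if "x \<in> PiE I S" for x
  proof -
    have "{\<omega> \<in> space M. X \<omega> = x} = X -` {x} \<inter> space M" by auto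
    then show ?thesis using measurable_sets[OF X, of "{x}"] that by simp
  qed
  have integrable: "integrable M (indicat_real {\<omega> \<in> space M. X \<omega> = x})" if "x \<in> PiE I S" for x
    using sets[OF that] by (intro integrable_real_indicator) (auto simp: emeasure_eq_measure)
  have "(\<integral>\<omega>. f (X \<omega> i) \<partial>M)
      = (\<integral>\<omega>. (\<Sum>x\<in>PiE I S. indicator {\<omega> \<in> space M. X \<omega> = x} \<omega> *\<^sub>R f (x i)) \<partial>M)"
  proof (rule Bochner_Integration.integral_cong[OF refl])
    fix \<omega> assume \<omega>: "\<omega> \<in> space M"
    then have "X \<omega> \<in> PiE I S" using measurable_space[OF X] by simp
    then have "f (X \<omega> i) = (\<Sum>x\<in>PiE I S. if x = X \<omega> then f (x i) else 0)"
      using finite_states by (simp add: sum.delta)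
    also have "\<dots> = (\<Sum>x\<in>PiE I S. indicator {\<omega> \<in> space M. X \<omega> = x} \<omega> *\<^sub>R f (x i))"
      using \<omega> by (intro sum.cong) (auto simp: indicator_def)
    finally show "f (X \<omega> i) = \<dots>" .
  qed
  also have "\<dots> = (\<Sum>x\<in>PiE I S. (\<integral>\<omega>. indicator {\<omega> \<in> space M. X \<omega> = x} \<omega> *\<^sub>R f (x i) \<partial>M))"
    by (intro Bochner_Integration.integral_sum integrable_scaleR_left integrable)
  also have "\<dots> = (\<Sum>x\<in>PiE I S. mass x *\<^sub>R f (x i))"
  proof (rule sum.cong[OF refl])
    fix x assume x: "x \<in> PiE I S"
    have "(\<integral>\<omega>. indicator {\<omega> \<in> space M. X \<omega> = x} \<omega> *\<^sub>R f (x i) \<partial>M)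
        = (\<integral>\<omega>. indicator {\<omega> \<in> space M. X \<omega> = x} \<omega> \<partial>M) *\<^sub>R f (x i)"
      by (intro integral_scaleR_left integrable[OF x])
    also have "\<dots> = measure M ({\<omega> \<in> space M. X \<omega> = x} \<inter> space M) *\<^sub>R f (x i)"
      by simp
    also have "{\<omega> \<in> space M. X \<omega> = x} \<inter> space M = {\<omega> \<in> space M. X \<omega> = x}" by auto
    finally show "(\<integral>\<omega>. indicator {\<omega> \<in> space M. X \<omega> = x} \<omega> *\<^sub>R f (x i) \<partial>M) = mass x *\<^sub>R f (x i)"
      using law[OF x] by simp
  qed
  also have "\<dots> = (\<Sum>y\<in>S i. q i y *\<^sub>R f y)" by (rule expectation_marginal[OF i])
  finally show ?thesis .
qed

end

lemma transpose_outer: "transpose (outer v) = outer v"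
  by (simp add: transpose_def outer_def vec_eq_iff mult.commute)

lemma transpose_sum: "transpose (\<Sum>i\<in>F. S i) = (\<Sum>i\<in>F. transpose (S i :: real^'n^'m))"
  by (simp add: transpose_def vec_eq_iff sum_component)

text \<open>
  This is how the eigenvalue assumption of the theorem is used: as a lower bound, in every direction
  \<open>u\<close>, of the mean curvature that a block contributes to the target function.
\<close>
lemma lambda_min_change_moment_matrix:
  fixes s :: "('e \<Rightarrow> nat) \<Rightarrow> real^'d"
  assumes int: "\<And>f :: ('e \<Rightarrow> nat) \<Rightarrow> real^'d^'d. (\<integral>\<omega>. f (Y \<omega>) \<partial>M) = (\<Sum>y\<in>T. p y *\<^sub>R f y)"
  shows "lambda_min (change_moment_matrix M E s Y) * (norm u)\<^sup>2
           \<le> (\<Sum>y\<in>T. p y * (\<Sum>m\<in>E. (u \<bullet> edge_change m s y)\<^sup>2))"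
proof -
  let ?S = "change_moment_matrix M E s Y"
  have S: "?S = (\<Sum>m\<in>E. \<Sum>y\<in>T. p y *\<^sub>R outer (edge_change m s y))"
    unfolding change_moment_matrix_def
    using int[of "\<lambda>y. outer (edge_change _ s y)"] by simp
  have "transpose ?S = ?S"
    by (simp add: S transpose_sum transpose_scalar transpose_outer)
  then have "lambda_min ?S * (norm u)\<^sup>2 \<le> u \<bullet> (?S *v u)"
    by (rule lambda_min_le_quadratic_form)
  also have "\<dots> = outer u \<bullet> ?S" by (simp add: inner_outer)
  also have "\<dots> = (\<Sum>m\<in>E. \<Sum>y\<in>T. p y * (u \<bullet> edge_change m s y)\<^sup>2)"
    by (simp add: S inner_sum_right inner_outer_outer)
  also have "\<dots> = (\<Sum>y\<in>T. \<Sum>m\<in>E. p y * (u \<bullet> edge_change m s y)\<^sup>2)" by (rule sum.swap)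
  finally show ?thesis by (simp add: sum_distrib_left)
qed

section \<open>The Stein score of an exponential family on edge configurations\<close>

lemma exp_logistic_balance: "exp a * logistic (b - a) + exp b * (logistic (b - a) - 1) = 0"
proof -
  have "exp b = exp a * exp (b - a)" by (simp flip: exp_add)
  then have "exp a * logistic (b - a) + exp b * (logistic (b - a) - 1)
      = exp a * (logistic (b - a) + exp (b - a) * (logistic (b - a) - 1))"
    by (simp add: algebra_simps)
  also have "logistic (b - a) + exp (b - a) * (logistic (b - a) - 1) = 0"
    using one_plus_exp_pos[of "b - a"] by (simp add: logistic_def divide_simps)
  finally show ?thesis by simp
qed

text \<open>
  The Stein identity. Given all other edges, the indicator of \<open>m\<close> is Bernoulli with parameter
  \<open>logistic (\<beta> \<bullet> edge_change m s y)\<close>. Equivalently, the summand changes sign when the edge \<open>m\<close> is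
  switched, and switching permutes the configurations.
\<close>
lemma edge_score_mean_zero:
  fixes s :: "('e \<Rightarrow> nat) \<Rightarrow> 'b :: euclidean_space"
  assumes m: "m \<in> E"
  shows "(\<Sum>y\<in>E \<rightarrow>\<^sub>E {0, 1}. (exp (\<beta> \<bullet> s y) * (logistic (\<beta> \<bullet> edge_change m s y) - real (y m)))
            *\<^sub>R edge_change m s y) = 0"
proof -
  define T where "T = E \<rightarrow>\<^sub>E {0, 1 :: nat}"
  define F where "F y = (exp (\<beta> \<bullet> s y) * (logistic (\<beta> \<bullet> edge_change m s y) - real (y m)))
      *\<^sub>R edge_change m s y" for y
  define flip where "flip y = y(m := 1 - y m)" for y :: "'e \<Rightarrow> nat"
  have T: "y m = 0 \<or> y m = 1" if "y \<in> T" for y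
    using that m by (auto simp: T_def dest!: PiE_mem)
  have flip_T: "flip y \<in> T" if "y \<in> T" for y
    using that m by (auto simp: T_def flip_def PiE_iff extensional_def)
  have flip_flip: "flip (flip y) = y" if "y \<in> T" for y
    using T[OF that] by (auto simp: flip_def)
  have anti: "F (flip y) = - F y" if "y \<in> T" for y
  proof -
    have change: "edge_change m s (flip y) = edge_change m s y"
      by (simp add: edge_change_def set_edge_def flip_def)
    let ?a = "\<beta> \<bullet> s (set_edge m 0 y)" and ?b = "\<beta> \<bullet> s (set_edge m 1 y)"
    have t: "\<beta> \<bullet> edge_change m s y = ?b - ?a"
      by (simp add: edge_change_def inner_diff_right)
    have "F y + F (flip y)
        = (exp ?a * logistic (?b - ?a) + exp ?b * (logistic (?b - ?a) - 1)) *\<^sub>R edge_change m s y"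
      using T[OF that]
    proof
      assume y: "y m = 0"
      then have "set_edge m 0 y = y" "set_edge m 1 y = flip y" "flip y m = 1"
        by (auto simp: set_edge_def flip_def)
      with y show ?thesis by (simp add: F_def change t scaleR_add_left)
    next
      assume y: "y m = 1"
      then have "set_edge m 1 y = y" "set_edge m 0 y = flip y" "flip y m = 0"
        by (auto simp: set_edge_def flip_def)
      with y show ?thesis by (simp add: F_def change t scaleR_add_left)
    qed
    then show ?thesis by (simp add: exp_logistic_balance add_eq_0_iff)
  qed
  have "(\<Sum>y\<in>T. F y) = (\<Sum>y\<in>T. F (flip y))"
    by (rule sum.reindex_bij_witness[of _ flip flip]) (auto simp: flip_T flip_flip)
  also have "\<dots> = - (\<Sum>y\<in>T. F y)"
    by (simp add: anti sum_negf)
  finally have "2 *\<^sub>R (\<Sum>y\<in>T. F y) = 0"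
    by (simp only: scaleR_2 add_eq_0_iff)
  then show ?thesis
    unfolding F_def T_def by simp
qed

text \<open>
  The target function is the logistic loss (negative log-pseudolikelihood) in which the response to
  the design vector \<open>edge_change m s y\<close> is the edge indicator \<open>y m\<close>.
\<close>
lemma block_target_eq_logistic_loss:
  assumes "y \<in> E \<rightarrow>\<^sub>E {0, 1}"
  shows "block_target E s y b
    = (\<Sum>m\<in>E. softplus (b \<bullet> edge_change m s y) - real (y m) * (b \<bullet> edge_change m s y))"
  unfolding block_target_def
proof (rule sum.cong[OF refl])
  fix m assume "m \<in> E"
  then have "y m = 0 \<or> y m = 1" using assms by (auto dest!: PiE_mem)
  then have "s (set_edge m 0 y) - s y = - (real (y m) *\<^sub>R edge_change m s y)"
  proof
    assume y: "y m = 0"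
    then have "set_edge m 0 y = y" by (auto simp: set_edge_def)
    with y show ?thesis by simp
  next
    assume y: "y m = 1"
    then have "set_edge m 1 y = y" by (auto simp: set_edge_def)
    with y show ?thesis by (simp add: edge_change_def)
  qed
  then show "softplus (b \<bullet> edge_change m s y) + b \<bullet> (s (set_edge m 0 y) - s y)
      = softplus (b \<bullet> edge_change m s y) - real (y m) * (b \<bullet> edge_change m s y)"
    by simp
qed

text \<open>
  Independent blocks of edges, block \<open>i\<close> with a Gibbs law of energy \<open>\<phi> i\<close>. Keeping the energies
  abstract allows within-block and between-block pairs, whose statistics have different dimensions,
  to live in one product law.
\<close>
locale exponential_blocks =
  fixes I :: "'i set" and E :: "'i \<Rightarrow> 'e set" and \<phi> :: "'i \<Rightarrow> ('e \<Rightarrow> nat) \<Rightarrow> real"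
  assumes finite_blocks: "finite I" and finite_edges: "i \<in> I \<Longrightarrow> finite (E i)"
begin

definition states :: "'i \<Rightarrow> ('e \<Rightarrow> nat) set" where
  "states i = E i \<rightarrow>\<^sub>E {0, 1}"

definition gibbs :: "'i \<Rightarrow> ('e \<Rightarrow> nat) \<Rightarrow> real" where
  "gibbs i y = exp (\<phi> i y) / (\<Sum>z\<in>states i. exp (\<phi> i z))"

lemma finite_block_states: "i \<in> I \<Longrightarrow> finite (states i)"
  unfolding states_def by (intro finite_PiE finite_edges) auto

sublocale finite_product_law I states gibbs
proof
  fix i assume i: "i \<in> I"
  have "states i \<noteq> {}" by (simp add: states_def PiE_eq_empty_iff)
  then have "(\<Sum>z\<in>states i. exp (\<phi> i z)) > 0"
    using finite_block_states[OF i] by (intro sum_pos) auto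
  then show "(\<Sum>y\<in>states i. gibbs i y) = 1"
    by (simp add: gibbs_def flip: sum_divide_distrib)
qed (auto simp: finite_blocks finite_block_states gibbs_def intro!: divide_nonneg_nonneg sum_nonneg)

lemma mass_eq_exp:
  "mass x = exp (\<Sum>i\<in>I. \<phi> i (x i)) / (\<Sum>y\<in>PiE I states. exp (\<Sum>i\<in>I. \<phi> i (y i)))"
proof -
  have "(\<Sum>y\<in>PiE I states. exp (\<Sum>i\<in>I. \<phi> i (y i))) = (\<Prod>i\<in>I. \<Sum>y\<in>states i. exp (\<phi> i y))"
    using finite_blocks finite_block_states by (simp add: exp_sum prod_sum_PiE)
  then show ?thesis
    using finite_blocks by (simp add: mass_def gibbs_def exp_sum prod_dividef)
qed

lemma stein_estimator_deviation:
  fixes s :: "'i \<Rightarrow> ('e \<Rightarrow> nat) \<Rightarrow> real^'d"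
  assumes J: "J \<subseteq> I" "J \<noteq> {}"
    and \<phi>: "\<And>j y. j \<in> J \<Longrightarrow> \<phi> j y = \<beta> \<bullet> s j y"
    and D: "\<And>j. j \<in> J \<Longrightarrow> real (card (E j)) \<le> D"
    and L: "0 \<le> L" "\<And>j m y. \<lbrakk>j \<in> J; m \<in> E j; y \<in> states j\<rbrakk> \<Longrightarrow> norm (edge_change m (s j) y) \<le> L"
    and \<xi>: "0 < \<xi>" "\<And>j u. j \<in> J \<Longrightarrow>
      \<xi> * (norm u)\<^sup>2 \<le> (\<Sum>y\<in>states j. gibbs j y * (\<Sum>m\<in>E j. (u \<bullet> edge_change m (s j) y)\<^sup>2))"
    and R: "0 < R" "norm \<beta> \<le> R"
    and P: "1 \<le> P"
    and hat: "\<And>x. x \<in> PiE I states \<Longrightarrow>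
      is_arg_min (\<lambda>b. \<Sum>j\<in>J. block_target (E j) (s j) (x j) b) (\<lambda>b. b \<in> cball 0 R) (hat x)"
  shows "event_prob (\<lambda>x. 32 * sqrt P * D * L * exp (R * L) / (\<xi> * sqrt (real (card J))) < norm (hat x - \<beta>))
           \<le> 1 / (2 * P)"
proof (rule logistic_minimiser_deviation[where v = "\<lambda>j m y. edge_change m (s j) y"
      and r = "\<lambda>j m y. real (y m)" and E = E])
  fix j assume j: "j \<in> J"
  let ?Z = "\<Sum>z\<in>states j. exp (\<phi> j z)"
  have "(\<Sum>y\<in>states j. gibbs j y *\<^sub>R (\<Sum>m\<in>E j.
          (logistic (\<beta> \<bullet> edge_change m (s j) y) - real (y m)) *\<^sub>R edge_change m (s j) y))
      = (\<Sum>y\<in>states j. \<Sum>m\<in>E j. (1 / ?Z) *\<^sub>R ((exp (\<beta> \<bullet> s j y) *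
          (logistic (\<beta> \<bullet> edge_change m (s j) y) - real (y m))) *\<^sub>R edge_change m (s j) y))"
    by (simp add: gibbs_def \<phi>[OF j] scaleR_sum_right)
  also have "\<dots> = (\<Sum>m\<in>E j. \<Sum>y\<in>states j. (1 / ?Z) *\<^sub>R ((exp (\<beta> \<bullet> s j y) *
          (logistic (\<beta> \<bullet> edge_change m (s j) y) - real (y m))) *\<^sub>R edge_change m (s j) y))"
    by (rule sum.swap)
  also have "\<dots> = (\<Sum>m\<in>E j. (1 / ?Z) *\<^sub>R (\<Sum>y\<in>states j. (exp (\<beta> \<bullet> s j y) *
          (logistic (\<beta> \<bullet> edge_change m (s j) y) - real (y m))) *\<^sub>R edge_change m (s j) y))"
    by (simp only: scaleR_sum_right)
  also have "\<dots> = 0"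
    unfolding states_def by (intro sum.neutral ballI) (simp only: edge_score_mean_zero scaleR_zero_right)
  finally show "(\<Sum>y\<in>states j. gibbs j y *\<^sub>R (\<Sum>m\<in>E j.
      (logistic (\<beta> \<bullet> edge_change m (s j) y) - real (y m)) *\<^sub>R edge_change m (s j) y)) = 0" .
next
  fix j m y assume "j \<in> J" "m \<in> E j" "y \<in> states j"
  then show "real (y m) \<in> {0..1}" by (auto simp: states_def dest!: PiE_mem)
next
  fix x assume x: "x \<in> PiE I states"
  then show "norm (hat x) \<le> R" using hat[OF x] by (simp add: is_arg_min_def)
  have xj: "x j \<in> E j \<rightarrow>\<^sub>E {0, 1}" if "j \<in> J" for j
    using PiE_mem[OF x, of j] J(1) that unfolding states_def by blast
  have "(\<Sum>j\<in>J. block_target (E j) (s j) (x j) b) = (\<Sum>j\<in>J. \<Sum>m\<in>E j.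
      softplus (b \<bullet> edge_change m (s j) (x j)) - real (x j m) * (b \<bullet> edge_change m (s j) (x j)))" for b
    by (intro sum.cong refl block_target_eq_logistic_loss xj)
  then show "(\<Sum>j\<in>J. \<Sum>m\<in>E j. softplus (hat x \<bullet> edge_change m (s j) (x j))
        - real (x j m) * (hat x \<bullet> edge_change m (s j) (x j)))
      \<le> (\<Sum>j\<in>J. \<Sum>m\<in>E j. softplus (\<beta> \<bullet> edge_change m (s j) (x j))
        - real (x j m) * (\<beta> \<bullet> edge_change m (s j) (x j)))"
    using hat[OF x] R(2) by (simp add: is_arg_min_def not_less)
qed (use assms in auto)

end

section \<open>The local dependency exponential random graph model\<close>

lemma finite_block_edges:
  assumes "finite (A k)" "finite (A l)"
  shows "finite (block_edges A k l)" and "card (block_edges A k l) \<le> card (A k) * card (A l)"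
proof -
  have sub: "block_edges A k l \<subseteq> (\<lambda>(u, v). {u, v}) ` (A k \<times> A l)"
    unfolding block_edges_def by auto
  have fin: "finite (A k \<times> A l)" using assms by simp
  show "finite (block_edges A k l)"
    using sub fin by (meson finite_imageI finite_subset)
  have "card (block_edges A k l) \<le> card (A k \<times> A l)"
    by (rule order_trans[OF card_mono[OF finite_imageI[OF fin] sub] card_image_le[OF fin]])
  then show "card (block_edges A k l) \<le> card (A k) * card (A l)"
    by (simp add: card_cartesian_product)
qed

lemma finite_between_pairs: "finite (between_pairs K)"
  by (rule finite_subset[of _ "{1..K} \<times> {1..K}"]) (auto simp: between_pairs_def)

text \<open>
  A linear lower bound suffices: the rate \<open>1 / sqrt K\<close> asks for a number of between-block pairs of
  order \<open>K\<close>, and already the neighbouring blocks \<open>(k, Suc k)\<close> supply it.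
\<close>
lemma card_between_pairs: "K - 1 \<le> card (between_pairs K)"
proof -
  have "(\<lambda>k. (k, Suc k)) ` {1..<K} \<subseteq> between_pairs K"
    by (auto simp: between_pairs_def)
  then have "card ((\<lambda>k. (k, Suc k)) ` {1..<K}) \<le> card (between_pairs K)"
    by (rule card_mono[OF finite_between_pairs])
  then show ?thesis by (simp add: card_image inj_on_def)
qed

locale lergm =
  fixes V :: "'v set" and K :: nat and A :: "nat \<Rightarrow> 'v set"
    and sW :: "nat \<Rightarrow> 'v subgraph \<Rightarrow> real^'d1" and sB :: "nat \<Rightarrow> nat \<Rightarrow> 'v subgraph \<Rightarrow> real^'d2"
    and \<beta>W :: "real^'d1" and \<beta>B :: "real^'d2"
  assumes partition: "block_partition V K A"
begin

definition pair_edges :: "nat \<times> nat \<Rightarrow> 'v set set" where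
  "pair_edges = (\<lambda>(k, l). block_edges A k l)"

definition energy :: "nat \<times> nat \<Rightarrow> 'v subgraph \<Rightarrow> real" where
  "energy = (\<lambda>(k, l) y. if k = l then \<beta>W \<bullet> sW k y else \<beta>B \<bullet> sB k l y)"

lemma pair_edges_pair [simp]: "pair_edges (k, l) = block_edges A k l"
  by (simp add: pair_edges_def)

lemma finite_block: "k \<in> {1..K} \<Longrightarrow> finite (A k)"
  using partition unfolding block_partition_def by (meson UN_upper finite_subset)

lemma finite_block_pairs: "finite (block_pairs K)"
  by (rule finite_subset[of _ "{1..K} \<times> {1..K}"]) (auto simp: block_pairs_def)

sublocale exponential_blocks "block_pairs K" pair_edges energy
proof
  show "finite (pair_edges p)" if "p \<in> block_pairs K" for p
    using that by (auto simp: block_pairs_def intro!: finite_block_edges finite_block)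
qed (rule finite_block_pairs)

lemma states_eq: "states (k, l) = subgraphs A k l"
  by (simp add: states_def subgraphs_def)

lemma graphs_eq: "graphs K A = PiE (block_pairs K) states"
  unfolding graphs_def by (rule PiE_cong) (auto simp: states_eq)

lemma block_size_le_max: "k \<in> {1..K} \<Longrightarrow> card (A k) \<le> max_block_size K A"
  unfolding max_block_size_def by (intro Max_ge) auto

lemma max_block_size_ge_1: "1 \<le> max_block_size K A"
proof -
  have K: "1 \<in> {1..K}" "A 1 \<noteq> {}"
    using partition by (auto simp: block_partition_def)
  then have "1 \<le> card (A 1)"
    using finite_block[of 1] by (simp add: Suc_le_eq card_gt_0_iff)
  with block_size_le_max[OF K(1)] show ?thesis by linarith
qed

lemma card_pair_edges_le:
  assumes "p \<in> block_pairs K"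
  shows "real (card (pair_edges p)) \<le> (real (max_block_size K A))\<^sup>2"
proof -
  obtain k l where p: "p = (k, l)" "k \<in> {1..K}" "l \<in> {1..K}"
    using assms by (auto simp: block_pairs_def)
  have "card (pair_edges p) \<le> card (A k) * card (A l)"
    using p by (simp add: finite_block_edges finite_block)
  also have "\<dots> \<le> max_block_size K A * max_block_size K A"
    using p by (intro mult_mono block_size_le_max) auto
  finally show ?thesis
    by (simp add: power2_eq_square flip: of_nat_mult)
qed

lemma diagonal_union_between: "block_pairs K = (\<lambda>k. (k, k)) ` {1..K} \<union> between_pairs K"
  by (auto simp: block_pairs_def between_pairs_def)

lemma lergm_weight_eq: "lergm_weight K sW sB \<beta>W \<beta>B x = exp (\<Sum>p\<in>block_pairs K. energy p (x p))"
proof -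
  have "(\<Sum>p\<in>block_pairs K. energy p (x p))
      = (\<Sum>p\<in>(\<lambda>k. (k, k)) ` {1..K}. energy p (x p)) + (\<Sum>p\<in>between_pairs K. energy p (x p))"
    unfolding diagonal_union_between
    by (rule sum.union_disjoint[OF _ finite_between_pairs]) (auto simp: between_pairs_def)
  also have "(\<Sum>p\<in>(\<lambda>k. (k, k)) ` {1..K}. energy p (x p)) = (\<Sum>k\<in>{1..K}. \<beta>W \<bullet> sW k (x (k, k)))"
    by (subst sum.reindex) (auto simp: inj_on_def energy_def)
  also have "(\<Sum>p\<in>between_pairs K. energy p (x p)) = (\<Sum>(k, l)\<in>between_pairs K. \<beta>B \<bullet> sB k l (x (k, l)))"
    by (intro sum.cong) (auto simp: between_pairs_def energy_def)
  finally show ?thesis by (simp add: lergm_weight_def)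
qed

text \<open>
  The energy is a sum over the block pairs, so the exponential weight and with it the normalising sum
  factorise: the subgraphs of a local dependency random graph are independent.
\<close>
lemma lergm_mass_eq: "lergm_mass K A sW sB \<beta>W \<beta>B x = mass x"
  by (simp add: lergm_mass_def lergm_weight_eq mass_eq_exp graphs_eq)

lemma information_lower_bound:
  fixes s :: "'v subgraph \<Rightarrow> real^'d"
  assumes "prob_space M" and X: "is_LERGM M X K A sW sB \<beta>W \<beta>B"
    and p: "p \<in> block_pairs K"
    and \<xi>: "\<xi> \<le> lambda_min (change_moment_matrix M (pair_edges p) s (\<lambda>\<omega>. X \<omega> p))"
  shows "\<xi> * (norm u)\<^sup>2 \<le> (\<Sum>y\<in>states p. gibbs p y * (\<Sum>m\<in>pair_edges p. (u \<bullet> edge_change m s y)\<^sup>2))"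
proof -
  have X': "X \<in> measurable M (count_space (PiE (block_pairs K) states))"
    "\<And>x. x \<in> PiE (block_pairs K) states \<Longrightarrow> measure M {\<omega> \<in> space M. X \<omega> = x} = mass x"
    using X by (auto simp: is_LERGM_def graphs_eq lergm_mass_eq)
  have "\<xi> * (norm u)\<^sup>2 \<le> lambda_min (change_moment_matrix M (pair_edges p) s (\<lambda>\<omega>. X \<omega> p)) * (norm u)\<^sup>2"
    using \<xi> by (intro mult_right_mono) auto
  also have "\<dots> \<le> (\<Sum>y\<in>states p. gibbs p y * (\<Sum>m\<in>pair_edges p. (u \<bullet> edge_change m s y)\<^sup>2))"
    by (intro lambda_min_change_moment_matrix integral_marginal assms(1) X' p)
  finally show ?thesis .
qed

lemma within_deviation:
  assumes M: "prob_space M" "is_LERGM M X K A sW sB \<beta>W \<beta>B"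
    and L: "0 \<le> L" "\<And>k x m. \<lbrakk>1 \<le> k; k \<le> K; x \<in> subgraphs A k k; m \<in> block_edges A k k\<rbrakk>
         \<Longrightarrow> norm (edge_change m (sW k) x) \<le> L"
    and \<xi>: "0 < \<xi>" "\<And>k. \<lbrakk>1 \<le> k; k \<le> K\<rbrakk> \<Longrightarrow>
         \<xi> \<le> lambda_min (change_moment_matrix M (block_edges A k k) (sW k) (\<lambda>\<omega>. X \<omega> (k, k)))"
    and R: "0 < R" "norm \<beta>W \<le> R" and P: "1 \<le> P"
    and hat: "\<And>x. x \<in> graphs K A \<Longrightarrow> is_arg_min (target_W K A sW x) (\<lambda>b. b \<in> cball 0 R) (hat x)"
  shows "event_prob (\<lambda>x. 32 * sqrt P * (real (max_block_size K A))\<^sup>2 * L * exp (R * L)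
             / (\<xi> * sqrt (real K)) < norm (hat x - \<beta>W)) \<le> 1 / (2 * P)"
proof -
  let ?J = "(\<lambda>k. (k, k)) ` {1..K}"
  have card: "card ?J = K" by (simp add: card_image inj_on_def)
  have K: "1 \<le> K" using partition by (simp add: block_partition_def)
  have sub: "?J \<subseteq> block_pairs K" using diagonal_union_between by blast
  have "event_prob (\<lambda>x. 32 * sqrt P * (real (max_block_size K A))\<^sup>2 * L * exp (R * L)
             / (\<xi> * sqrt (real (card ?J))) < norm (hat x - \<beta>W)) \<le> 1 / (2 * P)"
  proof (rule stein_estimator_deviation[where s = "\<lambda>(k, l). sW k"])
    show "?J \<noteq> {}" using K by simp
    show "real (card (pair_edges j)) \<le> (real (max_block_size K A))\<^sup>2" if "j \<in> ?J" for j
      using card_pair_edges_le that sub by blast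
    show "\<xi> * (norm u)\<^sup>2 \<le> (\<Sum>y\<in>states j. gibbs j y
        * (\<Sum>m\<in>pair_edges j. (u \<bullet> edge_change m (case j of (k, l) \<Rightarrow> sW k) y)\<^sup>2))" if "j \<in> ?J" for j u
      by (rule information_lower_bound[OF M])
         (use that sub \<xi>(2) in auto)
    show "norm (edge_change m (case j of (k, l) \<Rightarrow> sW k) y) \<le> L"
      if "j \<in> ?J" "m \<in> pair_edges j" "y \<in> states j" for j m y
      using that L(2) by (auto simp: states_eq)
    show "is_arg_min (\<lambda>b. \<Sum>j\<in>?J. block_target (pair_edges j) (case j of (k, l) \<Rightarrow> sW k) (x j) b)
        (\<lambda>b. b \<in> cball 0 R) (hat x)" if "x \<in> PiE (block_pairs K) states" for x
    proof -
      have "(\<lambda>b. \<Sum>j\<in>?J. block_target (pair_edges j) (case j of (k, l) \<Rightarrow> sW k) (x j) b)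
          = target_W K A sW x"
        by (rule ext, subst sum.reindex) (auto simp: inj_on_def target_W_def)
      with hat[of x] that show ?thesis by (simp only: graphs_eq)
    qed
  qed (use sub L(1) \<xi>(1) R P in \<open>auto simp: energy_def\<close>)
  then show ?thesis by (simp only: card)
qed

lemma between_deviation:
  assumes M: "prob_space M" "is_LERGM M X K A sW sB \<beta>W \<beta>B"
    and K: "2 \<le> K"
    and L: "0 \<le> L" "\<And>k l x m. \<lbrakk>1 \<le> k; k < l; l \<le> K; x \<in> subgraphs A k l; m \<in> block_edges A k l\<rbrakk>
         \<Longrightarrow> norm (edge_change m (sB k l) x) \<le> L"
    and \<xi>: "0 < \<xi>" "\<And>k l. \<lbrakk>1 \<le> k; k < l; l \<le> K\<rbrakk> \<Longrightarrow>
         \<xi> \<le> lambda_min (change_moment_matrix M (block_edges A k l) (sB k l) (\<lambda>\<omega>. X \<omega> (k, l)))"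
    and R: "0 < R" "norm \<beta>B \<le> R" and P: "1 \<le> P"
    and hat: "\<And>x. x \<in> graphs K A \<Longrightarrow> is_arg_min (target_B K A sB x) (\<lambda>b. b \<in> cball 0 R) (hat x)"
  shows "event_prob (\<lambda>x. 32 * sqrt P * (real (max_block_size K A))\<^sup>2 * L * exp (R * L)
             / (\<xi> * sqrt (real (card (between_pairs K)))) < norm (hat x - \<beta>B)) \<le> 1 / (2 * P)"
proof -
  let ?J = "between_pairs K"
  have sub: "?J \<subseteq> block_pairs K" using diagonal_union_between by blast
  show ?thesis
  proof (rule stein_estimator_deviation[where s = "\<lambda>(k, l). sB k l"])
    have "(1, 2) \<in> ?J" using K by (simp add: between_pairs_def)
    then show "?J \<noteq> {}" by blast
    show "real (card (pair_edges j)) \<le> (real (max_block_size K A))\<^sup>2" if "j \<in> ?J" for j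
      using card_pair_edges_le that sub by blast
    show "\<xi> * (norm u)\<^sup>2 \<le> (\<Sum>y\<in>states j. gibbs j y
        * (\<Sum>m\<in>pair_edges j. (u \<bullet> edge_change m (case j of (k, l) \<Rightarrow> sB k l) y)\<^sup>2))" if "j \<in> ?J" for j u
      by (rule information_lower_bound[OF M])
         (use that sub \<xi>(2) in \<open>auto simp: between_pairs_def\<close>)
    show "norm (edge_change m (case j of (k, l) \<Rightarrow> sB k l) y) \<le> L"
      if "j \<in> ?J" "m \<in> pair_edges j" "y \<in> states j" for j m y
      using that L(2) by (auto simp: states_eq between_pairs_def)
    show "is_arg_min (\<lambda>b. \<Sum>j\<in>?J. block_target (pair_edges j) (case j of (k, l) \<Rightarrow> sB k l) (x j) b)
        (\<lambda>b. b \<in> cball 0 R) (hat x)" if "x \<in> PiE (block_pairs K) states" for x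
    proof -
      have "(\<lambda>b. \<Sum>j\<in>?J. block_target (pair_edges j) (case j of (k, l) \<Rightarrow> sB k l) (x j) b)
          = target_B K A sB x"
        by (rule ext) (auto simp: target_B_def intro!: sum.cong)
      with hat[of x] that show ?thesis by (simp only: graphs_eq)
    qed
  qed (use sub L(1) \<xi>(1) R P in \<open>auto simp: energy_def between_pairs_def\<close>)
qed

end

text \<open>
  Brings the bound for \<open>N\<close> blocks with at most \<open>M\<^sup>2\<close> edges each and edge changes of size
  \<open>L * M powr C\<close> into the form of the theorem. Four times \<open>N\<close> leaves room for \<open>N = K - 1\<close> with
  \<open>K \<ge> 2\<close>; the summand \<open>2 * R\<close> of the constant is spent on a single block, where there are no
  between-block pairs.
\<close>
lemma deviation_bound_le_rate:
  fixes K M N P L R \<xi> C :: real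
  assumes "1 \<le> K" "K \<le> 4 * N" "1 \<le> M" "1 \<le> P" "0 \<le> L" "0 < R" "0 < \<xi>"
  shows "32 * sqrt P * M\<^sup>2 * (L * M powr C) * exp (R * (L * M powr C)) / (\<xi> * sqrt N)
    \<le> 1 / sqrt K * P * (64 * (L + 1) / \<xi> + 2 * R) * M powr (5 + C) * exp (R * L * M powr C)"
proof -
  have "sqrt K \<le> 2 * sqrt N"
    using assms real_sqrt_le_mono[OF assms(2)] by (simp add: real_sqrt_mult)
  then have N: "1 / sqrt N \<le> 2 / sqrt K"
    using assms by (simp add: divide_simps split: if_splits)
  have "sqrt P * sqrt P \<ge> sqrt P * 1" using assms by (intro mult_left_mono) auto
  then have P: "sqrt P \<le> P" using assms by simp
  have "M\<^sup>2 * M powr C = M powr (2 + C)"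
    using assms by (simp add: powr_add powr_numeral)
  also have "\<dots> \<le> M powr (5 + C)" using assms by (intro powr_mono) auto
  finally have M: "M\<^sup>2 * M powr C \<le> M powr (5 + C)" .
  have "32 * sqrt P * M\<^sup>2 * (L * M powr C) * exp (R * (L * M powr C)) / (\<xi> * sqrt N)
      = 32 * L / \<xi> * (sqrt P * (M\<^sup>2 * M powr C)) * (1 / sqrt N) * exp (R * L * M powr C)"
    by (simp add: mult_ac)
  also have "\<dots> \<le> 32 * L / \<xi> * (P * M powr (5 + C)) * (2 / sqrt K) * exp (R * L * M powr C)"
    using assms N P M
    by (intro mult_right_mono mult_mono mult_left_mono) auto
  also have "\<dots> = 64 * L / \<xi> * (P * M powr (5 + C) * (1 / sqrt K) * exp (R * L * M powr C))"
    by simp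
  also have "\<dots> \<le> (64 * (L + 1) / \<xi> + 2 * R) * (P * M powr (5 + C) * (1 / sqrt K) * exp (R * L * M powr C))"
  proof (rule mult_right_mono)
    have "64 * L / \<xi> \<le> 64 * (L + 1) / \<xi>" using assms by (intro divide_right_mono) auto
    then show "64 * L / \<xi> \<le> 64 * (L + 1) / \<xi> + 2 * R" using assms by linarith
  qed (use assms in auto)
  finally show ?thesis by (simp add: mult_ac)
qed

section \<open>Error bound of the Stein estimator\<close>

theorem theorem4p7:
  fixes \<Omega> :: "'w measure"
    and V :: "nat \<Rightarrow> 'v set"
    and K :: "nat \<Rightarrow> nat"
    and A :: "nat \<Rightarrow> nat \<Rightarrow> 'v set"
    and mx :: "nat \<Rightarrow> real"
    and sW :: "nat \<Rightarrow> nat \<Rightarrow> 'v subgraph \<Rightarrow> real^'d1"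
    and sB :: "nat \<Rightarrow> nat \<Rightarrow> nat \<Rightarrow> 'v subgraph \<Rightarrow> real^'d2"
    and X :: "nat \<Rightarrow> 'w \<Rightarrow> 'v block_graph"
    and \<beta>W :: "real^'d1" and \<beta>B :: "real^'d2"
    and R\<^sub>W R\<^sub>B L\<^sub>W L\<^sub>B C\<^sub>W C\<^sub>B \<xi>\<^sub>W \<xi>\<^sub>B :: real
    and hatW :: "nat \<Rightarrow> 'v block_graph \<Rightarrow> real^'d1"
    and hatB :: "nat \<Rightarrow> 'v block_graph \<Rightarrow> real^'d2"
  defines "mx \<equiv> \<lambda>n. real (max_block_size (K n) (A n))"
  assumes "prob_space \<Omega>"
    and "\<And>n. block_partition (V n) (K n) (A n)"
    and "\<And>n. is_LERGM \<Omega> (X n) (K n) (A n) (sW n) (sB n) \<beta>W \<beta>B"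
    and A1: "R\<^sub>W > 0" "R\<^sub>B > 0"
      "\<beta>W \<in> interior (cball 0 R\<^sub>W)" "\<beta>B \<in> interior (cball 0 R\<^sub>B)"
    and A2: "L\<^sub>W \<ge> 0" "L\<^sub>B \<ge> 0" "C\<^sub>W \<ge> 0" "C\<^sub>B \<ge> 0"
      "\<And>n k x m. \<lbrakk>1 \<le> k; k \<le> K n; x \<in> subgraphs (A n) k k; m \<in> block_edges (A n) k k\<rbrakk>
         \<Longrightarrow> norm (edge_change m (sW n k) x) \<le> L\<^sub>W * mx n powr C\<^sub>W"
      "\<And>n k l x m. \<lbrakk>1 \<le> k; k < l; l \<le> K n; x \<in> subgraphs (A n) k l; m \<in> block_edges (A n) k l\<rbrakk>
         \<Longrightarrow> norm (edge_change m (sB n k l) x) \<le> L\<^sub>B * mx n powr C\<^sub>B"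
    and A3: "\<xi>\<^sub>W > 0" "\<xi>\<^sub>B > 0"
      "\<And>n k. \<lbrakk>1 \<le> k; k \<le> K n\<rbrakk> \<Longrightarrow>
         lambda_min (change_moment_matrix \<Omega> (block_edges (A n) k k) (sW n k) (\<lambda>\<omega>. X n \<omega> (k, k)))
           \<ge> \<xi>\<^sub>W"
      "\<And>n k l. \<lbrakk>1 \<le> k; k < l; l \<le> K n\<rbrakk> \<Longrightarrow>
         lambda_min (change_moment_matrix \<Omega> (block_edges (A n) k l) (sB n k l) (\<lambda>\<omega>. X n \<omega> (k, l)))
           \<ge> \<xi>\<^sub>B"
    and hatW: "\<And>n x. x \<in> graphs (K n) (A n) \<Longrightarrow>
         is_arg_min (target_W (K n) (A n) (sW n) x) (\<lambda>b. b \<in> cball 0 R\<^sub>W) (hatW n x)"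
    and hatB: "\<And>n x. x \<in> graphs (K n) (A n) \<Longrightarrow>
         is_arg_min (target_B (K n) (A n) (sB n) x) (\<lambda>b. b \<in> cball 0 R\<^sub>B) (hatB n x)"
  shows "\<forall>P::nat. P \<ge> 1 \<longrightarrow> (\<exists>T\<^sub>W>0. \<exists>T\<^sub>B>0. \<forall>n.
     measure \<Omega> {\<omega> \<in> space \<Omega>.
         norm (hatW n (X n \<omega>) - \<beta>W)
           \<le> 1 / sqrt (real (K n)) * real P * T\<^sub>W * mx n powr (5 + C\<^sub>W) * exp (R\<^sub>W * L\<^sub>W * mx n powr C\<^sub>W) \<and>
         norm (hatB n (X n \<omega>) - \<beta>B)
           \<le> 1 / sqrt (real (K n)) * real P * T\<^sub>B * mx n powr (5 + C\<^sub>B) * exp (R\<^sub>B * L\<^sub>B * mx n powr C\<^sub>B)}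
       \<ge> 1 - 1 / real P)"
proof (intro allI impI)
  fix P :: nat
  assume "P \<ge> 1"
  then have P: "1 \<le> real P" by simp
  define T\<^sub>W where "T\<^sub>W = 64 * (L\<^sub>W + 1) / \<xi>\<^sub>W + 2 * R\<^sub>W"
  define T\<^sub>B where "T\<^sub>B = 64 * (L\<^sub>B + 1) / \<xi>\<^sub>B + 2 * R\<^sub>B"
  have T: "T\<^sub>W > 0" "T\<^sub>B > 0"
    using A1(1,2) A2(1,2) A3(1,2)
    by (simp_all add: T\<^sub>W_def T\<^sub>B_def add_nonneg_pos)
  have \<beta>: "norm \<beta>W \<le> R\<^sub>W" "norm \<beta>B \<le> R\<^sub>B"
    using A1(3,4) by (auto simp: interior_cball)
  have "1 - 1 / real P \<le> measure \<Omega> {\<omega> \<in> space \<Omega>.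
         norm (hatW n (X n \<omega>) - \<beta>W)
           \<le> 1 / sqrt (real (K n)) * real P * T\<^sub>W * mx n powr (5 + C\<^sub>W) * exp (R\<^sub>W * L\<^sub>W * mx n powr C\<^sub>W) \<and>
         norm (hatB n (X n \<omega>) - \<beta>B)
           \<le> 1 / sqrt (real (K n)) * real P * T\<^sub>B * mx n powr (5 + C\<^sub>B) * exp (R\<^sub>B * L\<^sub>B * mx n powr C\<^sub>B)}"
    for n
  proof -
    interpret lergm "V n" "K n" "A n" "sW n" "sB n" \<beta>W \<beta>B
      by unfold_locales (rule assms(3))
    define rW where "rW = 1 / sqrt (real (K n)) * real P * T\<^sub>W * mx n powr (5 + C\<^sub>W) * exp (R\<^sub>W * L\<^sub>W * mx n powr C\<^sub>W)"
    define rB where "rB = 1 / sqrt (real (K n)) * real P * T\<^sub>B * mx n powr (5 + C\<^sub>B) * exp (R\<^sub>B * L\<^sub>B * mx n powr C\<^sub>B)"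
    have M: "1 \<le> mx n" using max_block_size_ge_1 by (simp add: mx_def)
    have K: "1 \<le> K n" using assms(3)[of n] by (simp add: block_partition_def)
    have law: "X n \<in> measurable \<Omega> (count_space (PiE (block_pairs (K n)) states))"
      "\<And>x. x \<in> PiE (block_pairs (K n)) states \<Longrightarrow> measure \<Omega> {\<omega> \<in> space \<Omega>. X n \<omega> = x} = mass x"
      using assms(4)[of n] by (auto simp: is_LERGM_def graphs_eq lergm_mass_eq)
    have W: "event_prob (\<lambda>x. rW < norm (hatW n x - \<beta>W)) \<le> 1 / (2 * real P)"
    proof -
      have "event_prob (\<lambda>x. rW < norm (hatW n x - \<beta>W))
          \<le> event_prob (\<lambda>x. 32 * sqrt (real P) * (real (max_block_size (K n) (A n)))\<^sup>2 * (L\<^sub>W * mx n powr C\<^sub>W)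
             * exp (R\<^sub>W * (L\<^sub>W * mx n powr C\<^sub>W)) / (\<xi>\<^sub>W * sqrt (real (K n))) < norm (hatW n x - \<beta>W))"
        using deviation_bound_le_rate[of "real (K n)" "real (K n)" "mx n" "real P" L\<^sub>W R\<^sub>W \<xi>\<^sub>W C\<^sub>W]
          K M P A1 A2 A3
        by (intro event_prob_mono) (simp add: rW_def T\<^sub>W_def mx_def)
      also have "\<dots> \<le> 1 / (2 * real P)"
        by (rule within_deviation[OF assms(2) assms(4)[of n]])
           (use A1 A2(1,3) A2(5)[of _ n] A3(1) A3(3)[of _ n] \<beta> P hatW[of _ n] in \<open>auto simp: mx_def\<close>)
      finally show ?thesis .
    qed
    have B: "event_prob (\<lambda>x. rB < norm (hatB n x - \<beta>B)) \<le> 1 / (2 * real P)"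
    proof (cases "2 \<le> K n")
      case True
      have "real (K n) \<le> 4 * real (card (between_pairs (K n)))"
        using card_between_pairs[of "K n"] True by linarith
      then have "event_prob (\<lambda>x. rB < norm (hatB n x - \<beta>B))
          \<le> event_prob (\<lambda>x. 32 * sqrt (real P) * (real (max_block_size (K n) (A n)))\<^sup>2 * (L\<^sub>B * mx n powr C\<^sub>B)
             * exp (R\<^sub>B * (L\<^sub>B * mx n powr C\<^sub>B)) / (\<xi>\<^sub>B * sqrt (real (card (between_pairs (K n)))))
               < norm (hatB n x - \<beta>B))"
        using deviation_bound_le_rate[of "real (K n)" "real (card (between_pairs (K n)))" "mx n"
            "real P" L\<^sub>B R\<^sub>B \<xi>\<^sub>B C\<^sub>B] K M P A1 A2 A3
        by (intro event_prob_mono) (simp add: rB_def T\<^sub>B_def mx_def)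
      also have "\<dots> \<le> 1 / (2 * real P)"
        by (rule between_deviation[OF assms(2) assms(4)[of n] True])
           (use A1 A2(2,4) A2(6)[of _ _ n] A3(2) A3(4)[of _ _ n] \<beta> P hatB[of _ n] in \<open>auto simp: mx_def\<close>)
      finally show ?thesis .
    next
      case False
      then have "K n = 1" using K by simp
      \<comment> \<open>With a single block the between-block target is an empty sum, and the estimator is an
          arbitrary point of the ball; the bound is then at least the diameter of the ball.\<close>
      have "2 * R\<^sub>B \<le> T\<^sub>B" using A2 A3 by (simp add: T\<^sub>B_def)
      also have "T\<^sub>B * 1 \<le> T\<^sub>B * (real P * mx n powr (5 + C\<^sub>B) * exp (R\<^sub>B * L\<^sub>B * mx n powr C\<^sub>B))"
      proof (rule mult_left_mono)
        have "1 * 1 * 1 \<le> real P * mx n powr (5 + C\<^sub>B) * exp (R\<^sub>B * L\<^sub>B * mx n powr C\<^sub>B)"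
          using P M A1 A2 by (intro mult_mono) (auto simp: ge_one_powr_ge_zero)
        then show "1 \<le> real P * mx n powr (5 + C\<^sub>B) * exp (R\<^sub>B * L\<^sub>B * mx n powr C\<^sub>B)" by simp
      qed (use T in auto)
      finally have "2 * R\<^sub>B \<le> rB" using \<open>K n = 1\<close> by (simp add: rB_def mult_ac)
      moreover have "norm (hatB n x - \<beta>B) \<le> 2 * R\<^sub>B" if "x \<in> PiE (block_pairs (K n)) states" for x
        using hatB[of x n] that \<beta>(2) norm_triangle_ineq4[of "hatB n x" \<beta>B]
        by (simp add: graphs_eq is_arg_min_def)
      ultimately have "event_prob (\<lambda>x. rB < norm (hatB n x - \<beta>B)) \<le> event_prob (\<lambda>_. False)"
        by (intro event_prob_mono) fastforce
      also have "\<dots> \<le> 1 / (2 * real P)" by (simp add: event_prob_def)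
      finally show ?thesis .
    qed
    have "event_prob (\<lambda>x. \<not> (norm (hatW n x - \<beta>W) \<le> rW \<and> norm (hatB n x - \<beta>B) \<le> rB))
        \<le> event_prob (\<lambda>x. rW < norm (hatW n x - \<beta>W) \<or> rB < norm (hatB n x - \<beta>B))"
      by (intro event_prob_mono) auto
    also have "\<dots> \<le> 1 / (2 * real P) + 1 / (2 * real P)"
      using event_prob_union W B by (meson add_mono order_trans)
    finally have "1 - 1 / real P \<le> event_prob (\<lambda>x. norm (hatW n x - \<beta>W) \<le> rW \<and> norm (hatB n x - \<beta>B) \<le> rB)"
      by (subst event_prob_compl) simp
    also have "\<dots> = measure \<Omega> {\<omega> \<in> space \<Omega>. norm (hatW n (X n \<omega>) - \<beta>W) \<le> rW \<and> norm (hatB n (X n \<omega>) - \<beta>B) \<le> rB}"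
      by (rule measure_eq_event_prob[symmetric, OF assms(2) law])
    finally show ?thesis unfolding rW_def rB_def .
  qed
  with T show "\<exists>T\<^sub>W>0. \<exists>T\<^sub>B>0. \<forall>n.
     measure \<Omega> {\<omega> \<in> space \<Omega>.
         norm (hatW n (X n \<omega>) - \<beta>W)
           \<le> 1 / sqrt (real (K n)) * real P * T\<^sub>W * mx n powr (5 + C\<^sub>W) * exp (R\<^sub>W * L\<^sub>W * mx n powr C\<^sub>W) \<and>
         norm (hatB n (X n \<omega>) - \<beta>B)
           \<le> 1 / sqrt (real (K n)) * real P * T\<^sub>B * mx n powr (5 + C\<^sub>B) * exp (R\<^sub>B * L\<^sub>B * mx n powr C\<^sub>B)}
       \<ge> 1 - 1 / real P"
    by blast
qed

end
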